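(* Let $R\subset\mathbb{N}$ be a sublacunary good set. (i) Let $\alpha$ be irrational and let $\rho\in L^1(\mu_{R,\alpha})$ be a nonnegative function with $\int_{\mathbb{T}}\rho\,d\mu_{R,\alpha}=1$ which is bounded, i.e. $\|\rho\|_{L^\infty(\mu_{R,\alpha})}<\infty$. Then there is a good set $S\subset R$ representing the measure $\rho\cdot\mu_{R,\alpha}$ at $\alpha$ (that is, $\mu_{S,\alpha}=\rho\cdot\mu_{R,\alpha}$) and satisfying $$M_R(S)=\frac{1}{\|\rho\|_{L^\infty(\mu_{R,\alpha})}} .$$ (ii) Let $S$ be a good subset of $R$ with $\overline{M}_R(S)>0$. Then for every irrational $\beta$ the limit measure $\mu_{S,\beta}$ is absolutely continuous with respect to $\mu_{R,\beta}$. Furthermore, the Radon–Nikodym derivative $\rho_\beta:=\frac{d\mu_{S,\beta}}{d\mu_{R,\beta}}$ is a bounded function satisfying $$\|\rho_\beta\|_{L^\infty(\mu_{R,\beta})}\le\frac{1}{\overline{M}_R(S)} .$$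
   Context: $\mathbb{N}=\{1,2,3,\dots\}$, $\mathbb{T}=\mathbb{R}/\mathbb{Z}$ and $e(\beta)=e^{2\pi i\beta}$. A good set $S\subset\mathbb{N}$ is an infinite set of positive integers which, when listed in increasing order as $s_1<s_2<\dots$, has the property that $\lim_{N\to\infty}\frac1N\sum_{n=1}^N e(s_n\beta)$ exists for every real number $\beta$. For a good set $S$ and every $\beta\in\mathbb{T}$, the weak limit of probability measures $\mu_{S,\beta}:=\lim_{N\to\infty}\frac1N\sum_{n=1}^N\delta_{s_n\beta}$ on $\mathbb{T}$ exists (with $s_n\beta$ taken mod $1$). For $R\subset\mathbb{N}$ write $R(N)=R\cap[1,N]$. The set $R$ is called sublacunary if $\lim_{N\to\infty}\frac{\#R(N)}{\log N}=\infty$. For $S\subset R$, the relative mean of $S$ in $R$ is $M_R(S)=\lim_{N\to\infty}\frac{\#S(N)}{\#R(N)}$, provided the limit exists (the equality in (i) includes its existence), and the relative upper mean is $\overline{M}_R(S)=\limsup_{N\to\infty}\frac{\#S(N)}{\#R(N)}$. *)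

theory Defs
  imports "HOL-Probability.Probability"
begin

text \<open>The circle group $T = R/Z$, with the quotient topology; measures on it live on
  the \<^term>\<open>borel\<close> sets of this topology.\<close>

quotient_type circle = real / "\<lambda>x y :: real. x - y \<in> \<int>"
proof (rule equivpI)
  show "reflp (\<lambda>x y :: real. x - y \<in> \<int>)"
    by (simp add: reflp_def)
  show "symp (\<lambda>x y :: real. x - y \<in> \<int>)"
    by (metis (mono_tags, lifting) Ints_minus minus_diff_eq sympI)
  show "transp (\<lambda>x y :: real. x - y \<in> \<int>)"
  proof (rule transpI)
    fix x y z :: real
    assume "x - y \<in> \<int>" "y - z \<in> \<int>"
    then have "(x - y) + (y - z) \<in> \<int>" by (rule Ints_add)
    then show "x - z \<in> \<int>" by simp
  qed
qed

lift_definition to_circle :: "real \<Rightarrow> circle" is "\<lambda>x. x" .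

instantiation circle :: topological_space
begin

definition open_circle :: "circle set \<Rightarrow> bool" where
  "open_circle U \<longleftrightarrow> open (to_circle -` U)"

instance
  by standard (auto simp: open_circle_def vimage_Union)

end

definition e :: "real \<Rightarrow> complex" where
  "e \<beta> = exp (2 * of_real pi * \<i> * of_real \<beta>)"

text \<open>The increasing listing $s_1 < s_2 < \dots$ of an infinite set is \<^const>\<open>enumerate\<close>,
  shifted by one: $s_n$ is \<open>enumerate S (n - 1)\<close>.\<close>

definition good :: "nat set \<Rightarrow> bool" where
  "good S \<longleftrightarrow> S \<subseteq> {1..} \<and> infinite S \<and>
     (\<forall>\<beta> :: real. convergent
        (\<lambda>N. (1 / of_nat N) * (\<Sum>n = 1..N. e (real (enumerate S (n - 1)) * \<beta>))))"

definition empirical_measure :: "nat set \<Rightarrow> real \<Rightarrow> nat \<Rightarrow> circle measure" where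
  "empirical_measure S \<beta> N =
     distr (uniform_count_measure {1..N}) borel
       (\<lambda>n. to_circle (real (enumerate S (n - 1)) * \<beta>))"

lemma emeasure_empirical_measure:
  assumes "N \<ge> 1" and "A \<in> sets borel"
  shows "emeasure (empirical_measure S \<beta> N) A =
    ennreal ((1 / real N) * (\<Sum>n = 1..N. indicator A (to_circle (real (enumerate S (n - 1)) * \<beta>))))"
proof -
  let ?s = "\<lambda>n. to_circle (real (enumerate S (n - 1)) * \<beta>)"
  have "emeasure (empirical_measure S \<beta> N) A =
      emeasure (uniform_count_measure {1..N}) (?s -` A \<inter> {1..N})"
    unfolding empirical_measure_def using assms(2)
    by (subst emeasure_distr)
       (auto simp: space_uniform_count_measure measurable_def sets_uniform_count_measure)
  also have "\<dots> = ennreal (real (card (?s -` A \<inter> {1..N})) / real N)"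
    by (subst emeasure_uniform_count_measure) auto
  also have "real (card (?s -` A \<inter> {1..N})) = (\<Sum>n = 1..N. indicator A (?s n))"
    by (simp add: indicator_def sum.If_cases Int_def conj_commute)
  finally show ?thesis by simp
qed

definition weakly_converges ::
    "(nat \<Rightarrow> 'a::topological_space measure) \<Rightarrow> 'a measure \<Rightarrow> bool" where
  "weakly_converges M L \<longleftrightarrow>
     (\<forall>f :: 'a \<Rightarrow> real. continuous_on UNIV f \<longrightarrow> bounded (range f) \<longrightarrow>
        (\<lambda>N. integral\<^sup>L (M N) f) \<longlonglongrightarrow> integral\<^sup>L L f)"

definition limit_measure :: "nat set \<Rightarrow> real \<Rightarrow> circle measure" where
  "limit_measure S \<beta> =
     (THE L. sets L = sets borel \<and> prob_space L \<and>
        weakly_converges (empirical_measure S \<beta>) L)"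

definition count_upto :: "nat set \<Rightarrow> nat \<Rightarrow> nat" where
  "count_upto R N = card (R \<inter> {1..N})"

definition sublacunary :: "nat set \<Rightarrow> bool" where
  "sublacunary R \<longleftrightarrow>
     filterlim (\<lambda>N. real (count_upto R N) / ln (real N)) at_top sequentially"

definition has_relative_mean :: "nat set \<Rightarrow> nat set \<Rightarrow> real \<Rightarrow> bool" where
  "has_relative_mean R S m \<longleftrightarrow>
     (\<lambda>N. real (count_upto S N) / real (count_upto R N)) \<longlonglongrightarrow> m"

definition upper_relative_mean :: "nat set \<Rightarrow> nat set \<Rightarrow> ereal" where
  "upper_relative_mean R S =
     limsup (\<lambda>N. ereal (real (count_upto S N) / real (count_upto R N)))"

text \<open>Extended real values, so that the norm can be applied to \<^const>\<open>RN_deriv\<close> without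
  collapsing the value infinity.\<close>

definition Linf_norm :: "'a measure \<Rightarrow> ('a \<Rightarrow> ereal) \<Rightarrow> ereal" where
  "Linf_norm M f = esssup M (\<lambda>x. \<bar>f x\<bar>)"

end

theory Submission
  imports Defs
begin

text \<open>
  Write \<open>r n\<close> for the elements of \<open>R\<close> in increasing order and \<open>\<mu>\<close> for the limit measure of \<open>R\<close> at
  the given frequency. Limit measures exist by Helly's selection theorem together with the
  density of trigonometric polynomials, and integrals of continuous functions against them are
  limits of averages along the orbit (\<open>limit_measure_tendsto\<close>).

  For the second part, averages over \<open>S\<close> of a nonnegative continuous function are at most the
  averages over \<open>R\<close> divided by the relative frequency of \<open>S\<close> in \<open>R\<close>. Passing to the limit along
  cut-offs where that frequency is close to its upper limit bounds the integrals, and regularity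
  of Borel measures carries the inequality over to all Borel sets
  (\<open>measure_le_if_integral_le\<close>, \<open>limit_measure_subset_le\<close>). It bounds the density.

  For the first part, let \<open>B\<close> be the essential supremum of \<open>\<rho>\<close>. Suppose first that \<open>\<rho>\<close> is continuous,
  and keep each \<open>r n\<close> independently with probability \<open>p n\<close>, the value of \<open>\<rho> / B\<close> at the point
  \<open>r n * \<alpha>\<close> of the orbit. By Hoeffding's inequality and a union bound over a grid of frequencies,
  whose size is subexponential because \<open>R\<close> is sublacunary, almost every choice makes the exponential
  sums over the kept elements agree up to \<open>o(N)\<close> with the sums weighted by \<open>p\<close>, at all frequencies
  simultaneously (\<open>ex_selection\<close>). The weighted averages converge because \<open>R\<close> is good and \<open>\<rho>\<close> is a
  uniform limit of trigonometric polynomials.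

  In general \<open>\<rho>\<close> has no meaningful values on the countable orbit. It is therefore replaced by
  continuous functions \<open>g i\<close> converging to it in \<open>L\<^sup>1\<close>. The corresponding weights form a Cauchy sequence
  in Besicovitch's seminorm, and that seminorm is complete: following \<open>g j\<close> on the \<open>j\<close>-th of a
  sequence of rapidly growing blocks gives weights \<open>p\<close> with the required averages
  (\<open>avg_seminorm_complete\<close>, \<open>ex_weights\<close>). Convergence rates at the various frequencies need not be
  uniform, because the weights are compared with each other rather than their exponential sums.
\<close>

section \<open>The circle as a compact metric space\<close>

lemma e_eq_cis: "e x = cis (2 * pi * x)"
  by (simp add: e_def cis_conv_exp mult_ac)

lemma norm_e [simp]: "cmod (e x) = 1"
  by (simp add: e_eq_cis)

lemma e_0 [simp]: "e 0 = 1"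
  by (simp add: e_eq_cis)

lemma e_add: "e (x + y) = e x * e y"
  by (simp add: e_eq_cis cis_mult distrib_left)

lemma e_power: "e x ^ k = e (real k * x)"
  by (induction k) (simp_all add: e_add distrib_right)

lemma cnj_e: "cnj (e x) = e (- x)"
  by (simp add: e_eq_cis cis_cnj)

lemma e_eq_iff: "e x = e y \<longleftrightarrow> x - y \<in> \<int>"
proof -
  have "e x = e y \<longleftrightarrow> e (x - y) = 1"
    using e_add[of "x - y" y] by (metis add.right_neutral add_diff_cancel_left' add_diff_cancel_right' diff_add_cancel e_add
        mult.commute mult.right_neutral mult_cancel_right norm_e norm_zero zero_neq_one)
  also have "\<dots> \<longleftrightarrow> (\<exists>n::int. x - y = of_int n)"
  proof -
    have "2 * pi * (x - y) = of_int (2 * n) * pi \<longleftrightarrow> x - y = of_int n" for n :: int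
      by auto
    then show ?thesis
      unfolding e_def exp_eq_1 by simp
  qed
  also have "\<dots> \<longleftrightarrow> x - y \<in> \<int>"
    by (auto elim: Ints_cases)
  finally show ?thesis .
qed

lemma e_lipschitz: "cmod (e x - e y) \<le> 2 * pi * \<bar>x - y\<bar>"
proof -
  have "e x - e y = e y * (e (x - y) - 1)"
    using e_add[of y "x - y"] by (simp add: algebra_simps)
  then have "cmod (e x - e y) = cmod (exp (\<i> * of_real (2 * pi * (x - y))) - 1)"
    by (simp add: norm_mult e_eq_cis cis_conv_exp)
  also have "\<dots> = 2 * \<bar>sin (2 * pi * (x - y) / 2)\<bar>"
    by (rule dist_exp_i_1)
  also have "\<dots> \<le> 2 * pi * \<bar>x - y\<bar>"
    using abs_sin_x_le_abs_x[of "pi * (x - y)"] by (simp add: abs_mult)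
  finally show ?thesis .
qed

lemma continuous_on_e [continuous_intros]: "continuous_on A e"
  unfolding e_def by (intro continuous_intros)

lift_definition circle_emb :: "circle \<Rightarrow> complex" is e
  by (simp add: e_eq_iff)

lemma circle_emb_to_circle [simp]: "circle_emb (to_circle x) = e x"
  by transfer simp

lemma to_circle_surj: "\<exists>x. 0 \<le> x \<and> x \<le> 1 \<and> to_circle x = c"
proof (transfer, intro exI conjI)
  show "frac c - c \<in> \<int>" for c :: real
    by (simp add: frac_def)
qed (auto intro: less_imp_le frac_lt_1)

lemma to_circle_frac: "to_circle (frac x) = to_circle x"
  by transfer (simp add: frac_def)

lemma inj_circle_emb: "circle_emb x = circle_emb y \<longleftrightarrow> x = y"
  by transfer (simp add: e_eq_iff)

lemma continuous_to_circle: "continuous_on A to_circle"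
proof (rule continuous_on_subset[of UNIV])
  show "continuous_on UNIV to_circle"
    by (auto simp: continuous_on_open_vimage open_circle_def)
qed simp

lemma continuous_circle_emb: "continuous_on A circle_emb"
proof (rule continuous_on_subset[of UNIV])
  have "open (to_circle -` (circle_emb -` B))" if "open B" for B
  proof -
    have "to_circle -` (circle_emb -` B) = e -` B" by auto
    then show ?thesis
      using continuous_on_e[of UNIV] that by (simp add: continuous_on_open_vimage)
  qed
  then show "continuous_on UNIV circle_emb"
    by (auto simp: continuous_on_open_vimage open_circle_def[of "circle_emb -` _"])
qed simp

lemma compact_circle: "compact (UNIV :: circle set)"
proof -
  have "UNIV = to_circle ` {0..1}"
  proof (intro equalityI subsetI)
    fix c show "c \<in> to_circle ` {0..1}"
      using to_circle_surj[of c] by auto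
  qed simp
  then show ?thesis
    using compact_continuous_image[OF continuous_to_circle compact_Icc] by metis
qed

text \<open>The quotient topology is the one induced by the embedding into the complex plane because
  a continuous injection of a compact space into a Hausdorff space is closed.\<close>

lemma open_circle_eq_vimage:
  "open U \<longleftrightarrow> (\<exists>V. open V \<and> circle_emb -` V = U)"
proof
  assume "open U"
  then have "compact (- U)"
    using compact_Int_closed[OF compact_circle, of "- U"] by (simp add: closed_Compl)
  then have "closed (circle_emb ` (- U))"
    using continuous_circle_emb by (intro compact_imp_closed compact_continuous_image)
  moreover have "circle_emb -` (- circle_emb ` (- U)) = U"
    by (auto simp: inj_circle_emb)
  ultimately show "\<exists>V. open V \<and> circle_emb -` V = U"
    by (metis open_Compl)
next
  assume "\<exists>V. open V \<and> circle_emb -` V = U"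
  then show "open U"
    using continuous_circle_emb[of UNIV] by (auto simp: continuous_on_open_vimage)
qed

instantiation circle :: metric_space
begin

text \<open>The chordal metric. Metrizability and compactness give access to the Stone-Weierstrass
  theorem and to the regularity of finite Borel measures.\<close>

definition dist_circle :: "circle \<Rightarrow> circle \<Rightarrow> real" where
  "dist_circle x y = dist (circle_emb x) (circle_emb y)"

definition uniformity_circle :: "(circle \<times> circle) filter" where
  "uniformity_circle = (INF \<epsilon>\<in>{0<..}. principal {(x, y). dist x y < \<epsilon>})"

instance
proof
  show uni: "uniformity = (INF \<epsilon>\<in>{0<..}. principal {(x :: circle, y). dist x y < \<epsilon>})"
    by (rule uniformity_circle_def)
  have ev: "eventually P uniformity \<longleftrightarrow> (\<exists>\<epsilon>>0. \<forall>x y. dist x y < \<epsilon> \<longrightarrow> P (x, y))"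
    for P :: "circle \<times> circle \<Rightarrow> bool"
    unfolding uni
    by (subst eventually_INF_base)
       (auto simp: eventually_principal subset_eq intro: bexI[of _ "min _ _"])
  show "open U \<longleftrightarrow> (\<forall>x\<in>U. eventually (\<lambda>(x', y). x' = x \<longrightarrow> y \<in> U) uniformity)"
    for U :: "circle set"
  proof
    assume "open U"
    then obtain V where V: "open V" "circle_emb -` V = U"
      using open_circle_eq_vimage by auto
    show "\<forall>x\<in>U. eventually (\<lambda>(x', y). x' = x \<longrightarrow> y \<in> U) uniformity"
    proof
      fix x assume "x \<in> U"
      then obtain d where "d > 0" "\<And>z. dist z (circle_emb x) < d \<Longrightarrow> z \<in> V"
        using V open_dist by blast
      then show "eventually (\<lambda>(x', y). x' = x \<longrightarrow> y \<in> U) uniformity"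
        unfolding ev using V by (auto simp: dist_circle_def dist_commute intro!: exI[of _ d])
    qed
  next
    assume *: "\<forall>x\<in>U. eventually (\<lambda>(x', y). x' = x \<longrightarrow> y \<in> U) uniformity"
    have "\<exists>d>0. \<forall>y. dist x y < d \<longrightarrow> y \<in> U" if "x \<in> U" for x
      using bspec[OF * that] unfolding ev by auto
    then obtain d where d: "\<And>x. x \<in> U \<Longrightarrow> d x > 0" "\<And>x y. x \<in> U \<Longrightarrow> dist x y < d x \<Longrightarrow> y \<in> U"
      by metis
    have "circle_emb -` (\<Union>x\<in>U. ball (circle_emb x) (d x)) = U"
      using d by (force simp: dist_circle_def)
    then show "open U"
      unfolding open_circle_eq_vimage by (intro exI[of _ "\<Union>x\<in>U. ball (circle_emb x) (d x)"]) auto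
  qed
qed (auto simp: dist_circle_def inj_circle_emb intro: dist_triangle2)

end

instance circle :: polish_space
proof
  show "convergent X" if "Cauchy X" for X :: "nat \<Rightarrow> circle"
    using compact_imp_complete[OF compact_circle] that unfolding complete_def convergent_def
    by auto
  obtain B :: "complex set set" where B: "countable B" "topological_basis B"
    using ex_countable_basis by blast
  have "topological_basis ((\<lambda>V. circle_emb -` V) ` B)"
  proof (rule topological_basisI)
    fix U :: "circle set" and x assume "open U" "x \<in> U"
    then obtain V where V: "open V" "circle_emb -` V = U"
      using open_circle_eq_vimage by auto
    then obtain W where "W \<in> B" "circle_emb x \<in> W" "W \<subseteq> V"
      using B(2) \<open>x \<in> U\<close> topological_basisE by (metis vimage_eq)
    then show "\<exists>B'\<in>(\<lambda>V. circle_emb -` V) ` B. x \<in> B' \<and> B' \<subseteq> U"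
      using V by auto
  next
    show "open U" if "U \<in> (\<lambda>V. circle_emb -` V) ` B" for U :: "circle set"
      using that topological_basis_open[OF B(2)] unfolding open_circle_eq_vimage by blast
  qed
  then show "\<exists>B :: circle set set. countable B \<and> open = generate_topology B"
    using B(1) topological_basis_imp_subbasis by blast
qed

lemma bounded_continuous_circle:
  fixes f :: "circle \<Rightarrow> real"
  assumes "continuous_on UNIV f"
  obtains B where "0 \<le> B" "\<And>x. \<bar>f x\<bar> \<le> B"
proof -
  have "bounded (range f)"
    using compact_continuous_image[OF assms compact_circle] by (rule compact_imp_bounded)
  then obtain B where "\<forall>x. \<bar>f x\<bar> \<le> B"
    by (auto simp: bounded_iff)
  then show thesis
    using that[of B] abs_ge_zero order_trans by blast
qed

section \<open>Trigonometric polynomials\<close>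

text \<open>Because of the real part and the complex coefficients, nonnegative exponents suffice: the
  frequencies \<open>k\<close> and \<open>- k\<close> give the same functions.\<close>

inductive trig_poly :: "(circle \<Rightarrow> real) \<Rightarrow> bool" where
  monom: "trig_poly (\<lambda>x. Re (c * circle_emb x ^ k))"
| add: "trig_poly f \<Longrightarrow> trig_poly g \<Longrightarrow> trig_poly (\<lambda>x. f x + g x)"

lemma norm_circle_emb [simp]: "cmod (circle_emb x) = 1"
  by transfer simp

lemma trig_poly_continuous: "trig_poly f \<Longrightarrow> continuous_on UNIV f"
  by (induction rule: trig_poly.induct) (intro continuous_intros continuous_circle_emb; assumption)+

text \<open>Conjugation inverts points of the unit circle, so \<open>Re a * Re b = Re (a * b + a * cnj b) / 2\<close>
  turns a product of monomials into two monomials with exponents \<open>k + l\<close> and \<open>k - l\<close>.\<close>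

lemma trig_poly_monom_mult:
  assumes "l \<le> k"
  shows "trig_poly (\<lambda>x. Re (c * circle_emb x ^ k) * Re (d * circle_emb x ^ l))"
proof -
  have "Re (c * z ^ k) * Re (d * z ^ l) =
      Re (c * d / 2 * z ^ (k + l)) + Re (c * cnj d / 2 * z ^ (k - l))"
    if "cmod z = 1" for z
  proof -
    have "z * cnj z = 1"
      using that by (simp add: complex_norm_square[symmetric])
    then have "z ^ l * cnj (z ^ l) = 1"
      by (metis complex_cnj_power power_mult_distrib power_one)
    moreover have "z ^ k = z ^ (k - l) * z ^ l"
      using assms by (simp flip: power_add)
    ultimately have "z ^ k * cnj (z ^ l) = z ^ (k - l)"
      by (simp add: mult.assoc del: complex_cnj_power)
    then have "c * cnj d / 2 * z ^ (k - l) = (c * z ^ k) * cnj (d * z ^ l) / 2"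
      by (simp add: mult_ac)
    moreover have "c * d / 2 * z ^ (k + l) = (c * z ^ k) * (d * z ^ l) / 2"
      by (simp add: power_add)
    moreover have "Re a * Re b = Re (a * b / 2) + Re (a * cnj b / 2)" for a b
      by (simp add: field_simps)
    ultimately show ?thesis by (simp only:)
  qed
  then have "(\<lambda>x. Re (c * circle_emb x ^ k) * Re (d * circle_emb x ^ l)) =
     (\<lambda>x. Re (c * d / 2 * circle_emb x ^ (k + l)) + Re (c * cnj d / 2 * circle_emb x ^ (k - l)))"
    by simp
  then show ?thesis
    by (simp only: trig_poly.intros)
qed

lemma trig_poly_mult:
  assumes "trig_poly f" "trig_poly g"
  shows "trig_poly (\<lambda>x. f x * g x)"
  using assms(1)
proof induction
  case (monom c k)
  show ?case
    using assms(2)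
  proof induction
    case (monom d l)
    show ?case
      using trig_poly_monom_mult[of l k c d] trig_poly_monom_mult[of k l d c]
      by (cases "l \<le> k") (auto simp: mult.commute)
  next
    case (add f g)
    then show ?case
      using trig_poly.add by (fastforce simp: distrib_left)
  qed
next
  case (add f f')
  then show ?case
    using trig_poly.add by (fastforce simp: distrib_right)
qed

lemma trig_poly_dense:
  assumes "continuous_on UNIV f" and "0 < \<epsilon>"
  obtains g where "trig_poly g" "\<And>x. \<bar>f x - g x\<bar> < \<epsilon>"
proof -
  have "\<exists>g. trig_poly g \<and> (\<forall>x\<in>UNIV. \<bar>f x - g x\<bar> < \<epsilon>)"
  proof (rule Stone_Weierstrass_HOL[OF compact_circle])
    show "trig_poly (\<lambda>x. c)" for c
      using monom[of "of_real c" 0] by simp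
    show "\<exists>f. trig_poly f \<and> f x \<noteq> f y" if "x \<in> UNIV \<and> y \<in> UNIV \<and> x \<noteq> y" for x y
    proof -
      have "circle_emb x \<noteq> circle_emb y"
        using that inj_circle_emb by auto
      then consider "Re (circle_emb x) \<noteq> Re (circle_emb y)" | "Im (circle_emb x) \<noteq> Im (circle_emb y)"
        using complex_eqI by blast
      then show ?thesis
      proof cases
        case 1
        then show ?thesis
          using monom[of 1 1] by (intro exI[of _ "\<lambda>x. Re (circle_emb x)"]) simp
      next
        case 2
        then show ?thesis
          using monom[of "-\<i>" 1] by (intro exI[of _ "\<lambda>x. Im (circle_emb x)"]) simp
      qed
    qed
  qed (use trig_poly_continuous trig_poly_mult trig_poly.add assms in auto)
  then show thesis
    using that by auto
qed

section \<open>Averages of bounded sequences\<close>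

definition avg :: "(nat \<Rightarrow> 'a :: real_normed_vector) \<Rightarrow> nat \<Rightarrow> 'a" where
  "avg a N = (1 / real N) *\<^sub>R (\<Sum>n<N. a n)"

lemma avg_add: "avg (\<lambda>n. a n + b n) N = avg a N + avg b N"
  by (simp add: avg_def sum.distrib scaleR_add_right)

lemma avg_diff: "avg (\<lambda>n. a n - b n) N = avg a N - avg b N"
  by (simp add: avg_def sum_subtractf scaleR_diff_right)

lemma avg_mult_left: "avg (\<lambda>n. c * a n) N = c * avg a N" for c :: "'a :: real_normed_algebra"
  by (simp add: avg_def sum_distrib_left[symmetric])

lemma avg_bounded_linear: "bounded_linear h \<Longrightarrow> avg (\<lambda>n. h (a n)) N = h (avg a N)"
  by (simp add: avg_def bounded_linear.linear linear_sum linear_scale)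

lemma avg_mono:
  fixes a b :: "nat \<Rightarrow> real"
  assumes "\<And>n. a n \<le> b n"
  shows "avg a N \<le> avg b N"
  using assms by (auto simp: avg_def intro!: divide_right_mono sum_mono)

lemma norm_avg_le: "norm (avg a N) \<le> avg (\<lambda>n. norm (a n)) N"
  by (auto simp: avg_def intro!: divide_right_mono sum_norm_le)

lemma avg_const: "N > 0 \<Longrightarrow> avg (\<lambda>_. c) N = c"
  by (simp add: avg_def sum_constant_scaleR)

lemma avg_le_bound:
  fixes a :: "nat \<Rightarrow> real"
  assumes "\<And>n. a n \<le> c" "0 \<le> c"
  shows "avg a N \<le> c"
  using avg_mono[of a "\<lambda>_. c" N, OF assms(1)] avg_const[of N c] assms(2)
  by (cases "N = 0") (auto simp: avg_def)

lemma avg_bigo_bounded: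
  fixes a :: "nat \<Rightarrow> real"
  assumes "\<And>N. (\<Sum>n<N. a n) \<le> K + c * real N" and "c < d"
  shows "eventually (\<lambda>N. avg a N \<le> d) sequentially"
proof -
  have "(\<lambda>N. K / real N) \<longlonglongrightarrow> 0"
    by (rule tendsto_divide_0[OF tendsto_const]) (simp add: filterlim_at_infinity_conv_norm_at_top
        filterlim_real_sequentially)
  then have "eventually (\<lambda>N. K / real N < d - c) sequentially"
    using assms(2) by (intro order_tendstoD(2)) auto
  then show ?thesis
    using eventually_gt_at_top[of 0]
  proof eventually_elim
    case (elim N)
    have "avg a N \<le> (K + c * real N) / real N"
      using assms(1)[of N] by (simp add: avg_def divide_right_mono)
    also have "\<dots> = K / real N + c"
      using elim by (simp add: field_simps)
    finally show ?case using elim by simp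
  qed
qed

text \<open>The upper mean of \<open>norm (w - v)\<close> is Besicovitch's seminorm of \<open>w - v\<close>. All late averages of
  \<open>w\<close> are as close to those of \<open>v\<close> as this seminorm says, so they inherit the Cauchy property from
  approximating sequences that have means.\<close>

lemma avg_convergent_approx:
  fixes w :: "nat \<Rightarrow> 'a :: banach"
  assumes v: "\<And>i. avg (v i) \<longlonglongrightarrow> l i"
    and d: "d \<longlonglongrightarrow> 0"
    and close: "\<And>i. eventually (\<lambda>N. avg (\<lambda>n. norm (w n - v i n)) N \<le> d i) sequentially"
  obtains L where "avg w \<longlonglongrightarrow> L" "l \<longlonglongrightarrow> L"
proof -
  have diff: "eventually (\<lambda>N. norm (avg w N - avg (v i) N) \<le> d i) sequentially" for i
    using close[of i]
    by eventually_elim (metis avg_diff norm_avg_le order_trans)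
  have "Cauchy (avg w)"
  proof (rule metric_CauchyI)
    fix \<epsilon> :: real assume "\<epsilon> > 0"
    then obtain i where i: "d i < \<epsilon> / 4"
      using order_tendstoD(2)[OF d, of "\<epsilon> / 4"] by (auto simp: eventually_sequentially)
    have "eventually (\<lambda>N. dist (avg (v i) N) (l i) < \<epsilon> / 4) sequentially"
      using v \<open>\<epsilon> > 0\<close> by (intro tendstoD) auto
    with diff[of i] have "eventually (\<lambda>N. dist (avg w N) (l i) < \<epsilon> / 2) sequentially"
    proof eventually_elim
      case (elim N)
      have "dist (avg w N) (l i) \<le> dist (avg w N) (avg (v i) N) + dist (avg (v i) N) (l i)"
        by (rule dist_triangle)
      with elim i show ?case by (simp add: dist_norm)
    qed
    then obtain M where "\<And>N. N \<ge> M \<Longrightarrow> dist (avg w N) (l i) < \<epsilon> / 2"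
      by (auto simp: eventually_sequentially)
    then show "\<exists>M. \<forall>m\<ge>M. \<forall>n\<ge>M. dist (avg w m) (avg w n) < \<epsilon>"
      by (meson dist_triangle_half_l)
  qed
  then obtain L where L: "avg w \<longlonglongrightarrow> L"
    using Cauchy_convergent_iff convergent_def by blast
  have "norm (L - l i) \<le> d i" for i
    by (rule tendsto_upperbound[OF tendsto_norm[OF tendsto_diff[OF L v]] diff]) simp
  then have "l \<longlonglongrightarrow> L"
    using Lim_null_comparison[of "\<lambda>i. l i - L" d sequentially] d
    by (auto simp: norm_minus_commute intro: LIM_zero_cancel)
  with L that show thesis by blast
qed

text \<open>Completeness of the Besicovitch seminorm: the limit of a Cauchy sequence \<open>w 0, w 1, \<dots>\<close>
  follows \<open>w j\<close> on the block \<open>T j \<le> n < T (j + 1)\<close>. The cut points \<open>T j\<close> at least double, so the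
  errors inherited from the earlier blocks do not accumulate, and they come so late that all the
  averages compared up to stage \<open>j\<close> have settled.\<close>

lemma avg_seminorm_complete:
  fixes w :: "nat \<Rightarrow> nat \<Rightarrow> 'a :: real_normed_vector"
  assumes cauchy: "\<And>i j. i \<le> j \<Longrightarrow>
      eventually (\<lambda>N. avg (\<lambda>n. norm (w j n - w i n)) N \<le> d i) sequentially"
    and pos: "\<And>i. 0 < d i"
  obtains J where "\<And>i. eventually (\<lambda>N. avg (\<lambda>n. norm (w (J n) n - w i n)) N \<le> 4 * d i) sequentially"
proof -
  define P where "P j M \<longleftrightarrow> (\<forall>i\<le>j. \<forall>N\<ge>M. (\<Sum>n<N. norm (w j n - w i n)) \<le> d i * real N)" for j M
  have ex: "\<exists>M. P j M" for j
  proof -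
    have "eventually (\<lambda>N. \<forall>i\<in>{..j}. (\<Sum>n<N. norm (w j n - w i n)) \<le> d i * real N) sequentially"
    proof (rule eventually_ball_finite)
      show "\<forall>i\<in>{..j}. eventually (\<lambda>N. (\<Sum>n<N. norm (w j n - w i n)) \<le> d i * real N) sequentially"
      proof
        fix i assume "i \<in> {..j}"
        then have "eventually (\<lambda>N. avg (\<lambda>n. norm (w j n - w i n)) N \<le> d i) sequentially"
          using cauchy by simp
        then show "eventually (\<lambda>N. (\<Sum>n<N. norm (w j n - w i n)) \<le> d i * real N) sequentially"
          using eventually_gt_at_top[of 0]
          by eventually_elim (simp add: avg_def field_simps)
      qed
    qed simp
    then show ?thesis
      unfolding P_def eventually_sequentially by auto
  qed
  have mono: "P j M \<Longrightarrow> M \<le> M' \<Longrightarrow> P j M'" for j M M'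
    unfolding P_def by auto
  obtain S where S: "\<And>j. P j (S j)"
    using ex by metis
  define T where "T = rec_nat 0 (\<lambda>j t. S (Suc j) + 2 * t + 1)"
  have T0: "T 0 = 0" and TS: "T (Suc j) = S (Suc j) + 2 * T j + 1" for j
    by (simp_all add: T_def)
  have PT: "P j (T j)" if "j > 0" for j
    using that S[of j] mono[OF S[of j], of "T j"] TS by (cases j) auto
  have T_less: "T j < T (Suc j)" for j
    by (simp add: TS)
  then have T_mono: "strict_mono T"
    by (rule strict_mono_Suc_iff[THEN iffD2, rule_format])
  \<comment> \<open>the number of the block containing \<open>n\<close>\<close>
  define J where "J n = (LEAST j. n < T (Suc j))" for n
  have J_eq: "J n = j" if "T j \<le> n" "n < T (Suc j)" for n j
  proof -
    have "\<not> n < T (Suc i)" if "i < j" for i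
      using \<open>T j \<le> n\<close> strict_mono_less_eq[OF T_mono, of "Suc i" j] that by simp
    then show ?thesis
      unfolding J_def using that by (intro Least_equality) (auto simp: not_less[symmetric])
  qed
  have bound: "eventually (\<lambda>N. avg (\<lambda>n. norm (w (J n) n - w i n)) N \<le> 4 * d i) sequentially" for i
  proof -
    let ?D = "\<lambda>N. \<Sum>n<N. norm (w (J n) n - w i n)"
    define K where "K = ?D (T (Suc i))"
    have block: "?D N \<le> ?D (T j) + d i * real N"
      if j: "i < j" "T j \<le> N" "N \<le> T (Suc j)" for j N
    proof -
      have "?D N = ?D (T j) + (\<Sum>n=T j..<N. norm (w (J n) n - w i n))"
        using j(2) by (simp add: sum.atLeastLessThan_concat flip: atLeast0LessThan)
      also have "(\<Sum>n=T j..<N. norm (w (J n) n - w i n)) = (\<Sum>n=T j..<N. norm (w j n - w i n))"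
        using j(3) J_eq by (intro sum.cong) auto
      also have "\<dots> \<le> (\<Sum>n<N. norm (w j n - w i n))"
        by (intro sum_mono2) auto
      also have "\<dots> \<le> d i * real N"
        using PT[of j] j unfolding P_def by auto
      finally show ?thesis by simp
    qed
    have ends: "?D (T j) \<le> K + 2 * d i * real (T j)" if "Suc i \<le> j" for j
      using that
    proof (induction j rule: dec_induct)
      case base
      then show ?case using pos[of i] by (simp add: K_def)
    next
      case (step j)
      have "?D (T (Suc j)) \<le> ?D (T j) + d i * real (T (Suc j))"
        using step.hyps T_less[of j] by (intro block) auto
      also have "\<dots> \<le> K + d i * (2 * real (T j)) + d i * real (T (Suc j))"
        using step.IH by simp
      also have "d i * (2 * real (T j)) \<le> d i * real (T (Suc j))"
        using pos[of i] by (intro mult_left_mono) (auto simp: TS)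
      finally show ?case by simp
    qed
    have "?D N \<le> K + 3 * d i * real N" for N
    proof (cases "N \<le> T (Suc i)")
      case True
      then have "?D N \<le> K"
        unfolding K_def by (intro sum_mono2) auto
      then show ?thesis using pos[of i] by (simp add: add_increasing2)
    next
      case False
      define j where "j = J N"
      have "\<exists>j. N < T (Suc j)"
        using strict_mono_imp_increasing[OF T_mono, of "Suc N"] by (intro exI[of _ N]) simp
      then have j1: "N < T (Suc j)"
        unfolding j_def J_def by (rule LeastI_ex)
      have "i < j"
        using j1 False strict_mono_less_eq[OF T_mono, of "Suc j" "Suc i"] by (rule_tac ccontr) simp
      then have "T j \<le> N"
        using not_less_Least[of "j - 1" "\<lambda>j. N < T (Suc j)"] unfolding j_def[unfolded J_def, symmetric]
        by (cases j) auto
      have "?D N \<le> ?D (T j) + d i * real N"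
        using \<open>i < j\<close> \<open>T j \<le> N\<close> j1 by (intro block) auto
      also have "?D (T j) \<le> K + 2 * d i * real (T j)"
        using \<open>i < j\<close> by (intro ends) simp
      also have "2 * d i * real (T j) \<le> 2 * d i * real N"
        using pos[of i] \<open>T j \<le> N\<close> by (intro mult_left_mono) auto
      finally show ?thesis by (simp add: algebra_simps)
    qed
    then show ?thesis
      using pos[of i] by (intro avg_bigo_bounded[where c = "3 * d i"]) auto
  qed
  then show thesis by (rule that)
qed

section \<open>Borel measures tested against continuous functions\<close>

lemma open_indicator_limit:
  fixes U :: "'a :: metric_space set"
  assumes "open U"
  obtains f :: "nat \<Rightarrow> 'a \<Rightarrow> real"
  where "\<And>n. continuous_on UNIV (f n)" "\<And>n x. 0 \<le> f n x" "\<And>n x. f n x \<le> 1"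
    "\<And>x. (\<lambda>n. f n x) \<longlonglongrightarrow> indicator U x"
proof (cases "U = UNIV")
  case True
  then show ?thesis by (intro that[of "\<lambda>_ _. 1"]) auto
next
  case False
  define f where "f n x = min 1 (real n * infdist x (- U))" for n :: nat and x
  show ?thesis
  proof (rule that[of f])
    show "continuous_on UNIV (f n)" for n
      unfolding f_def by (intro continuous_intros)
    show "(\<lambda>n. f n x) \<longlonglongrightarrow> indicator U x" for x
    proof (cases "x \<in> U")
      case True
      define \<delta> where "\<delta> = infdist x (- U)"
      have "\<delta> > 0"
        using True False assms in_closed_iff_infdist_zero[of "- U" x] infdist_nonneg[of x "- U"]
        unfolding \<delta>_def by (auto simp: closed_Compl less_le)
      have "eventually (\<lambda>n. 1 / \<delta> \<le> real n) sequentially"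
        by real_asymp
      then have "eventually (\<lambda>n. f n x = 1) sequentially"
      proof eventually_elim
        case (elim n)
        then show ?case using \<open>\<delta> > 0\<close> by (simp add: f_def \<delta>_def[symmetric] field_simps)
      qed
      then show ?thesis using True by (simp add: tendsto_eventually)
    next
      case False
      then show ?thesis by (simp add: f_def)
    qed
  qed (auto simp: f_def infdist_nonneg)
qed

lemma outer_regular_open:
  fixes L :: "'a :: {second_countable_topology, complete_space} measure"
  assumes "finite_measure L" "sets L = sets borel" "A \<in> sets borel" "0 < \<epsilon>"
  obtains U where "open U" "A \<subseteq> U" "measure L U < measure L A + \<epsilon>"
proof -
  interpret finite_measure L by fact
  have "emeasure L A < ennreal (measure L A + \<epsilon>)"
    using assms(4) by (simp add: emeasure_eq_measure)
  also have "emeasure L A = (INF U\<in>{U. A \<subseteq> U \<and> open U}. emeasure L U)"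
    using assms by (intro outer_regular) auto
  finally obtain U where U: "A \<subseteq> U" "open U" "emeasure L U < ennreal (measure L A + \<epsilon>)"
    by (auto simp: INF_less_iff)
  then have "measure L U < measure L A + \<epsilon>"
    using assms(4) by (simp add: emeasure_eq_measure ennreal_less_iff del: ennreal_plus)
  with U that show thesis by blast
qed

lemma integral_open_indicator_limit:
  fixes f :: "nat \<Rightarrow> 'a :: metric_space \<Rightarrow> real"
  assumes "finite_measure M" "sets M = sets borel" "open U"
    and f: "\<And>n. continuous_on UNIV (f n)" "\<And>n x. 0 \<le> f n x" "\<And>n x. f n x \<le> 1"
    "\<And>x. (\<lambda>n. f n x) \<longlonglongrightarrow> indicator U x"
  shows "(\<lambda>n. integral\<^sup>L M (f n)) \<longlonglongrightarrow> measure M U"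
proof -
  interpret finite_measure M by fact
  have [measurable_cong]: "sets M = sets borel" by fact
  have [measurable]: "f n \<in> borel_measurable M" for n
    using f(1) borel_measurable_continuous_onI measurable_cong_sets[OF assms(2) refl] by blast
  have [measurable]: "U \<in> sets M"
    using assms by simp
  have "(\<lambda>n. integral\<^sup>L M (f n)) \<longlonglongrightarrow> (\<integral>x. indicator U x \<partial>M)"
    using f by (intro integral_dominated_convergence[where w = "\<lambda>_. 1"]) (auto simp: abs_of_nonneg)
  then show ?thesis
    by simp
qed

text \<open>The inequality passes from continuous functions to open sets by monotone approximation
  and from open sets to Borel sets by outer regularity of the larger measure.\<close>

lemma measure_le_if_integral_le:
  fixes M L :: "'a :: {second_countable_topology, complete_space} measure"
  assumes M: "finite_measure M" "sets M = sets borel"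
    and L: "finite_measure L" "sets L = sets borel"
    and c: "0 \<le> c"
    and le: "\<And>f. continuous_on UNIV f \<Longrightarrow> (\<And>x. 0 \<le> f x) \<Longrightarrow> (\<And>x. f x \<le> 1) \<Longrightarrow>
        integral\<^sup>L M f \<le> c * integral\<^sup>L L f"
    and A: "A \<in> sets borel"
  shows "measure M A \<le> c * measure L A"
proof -
  have op: "measure M U \<le> c * measure L U" if U: "open U" for U
  proof -
    obtain f :: "nat \<Rightarrow> 'a \<Rightarrow> real" where f: "\<And>n. continuous_on UNIV (f n)"
      "\<And>n x. 0 \<le> f n x" "\<And>n x. f n x \<le> 1" "\<And>x. (\<lambda>n. f n x) \<longlonglongrightarrow> indicator U x"
      using open_indicator_limit[OF U] by metis
    show ?thesis
      by (rule LIMSEQ_le[OF integral_open_indicator_limit[OF M U f]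
            tendsto_mult_left[OF integral_open_indicator_limit[OF L U f]]])
         (use le f in blast)
  qed
  have "measure M A \<le> c * measure L A + c * \<epsilon>" if \<epsilon>: "0 < \<epsilon>" for \<epsilon>
  proof -
    interpret M: finite_measure M by fact
    obtain U where U: "open U" "A \<subseteq> U" "measure L U < measure L A + \<epsilon>"
      using outer_regular_open[OF L A \<epsilon>] .
    have "measure M A \<le> measure M U"
      using U A M by (intro M.finite_measure_mono) auto
    also have "\<dots> \<le> c * measure L U"
      by (rule op[OF U(1)])
    also have "\<dots> \<le> c * (measure L A + \<epsilon>)"
      using U c by (intro mult_left_mono) auto
    finally show ?thesis by (simp add: distrib_left)
  qed
  note step = this
  show ?thesis
  proof (rule field_le_epsilon)
    fix \<epsilon> :: real assume "0 < \<epsilon>"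
    have "c * (\<epsilon> / (c + 1)) \<le> \<epsilon>"
      using c \<open>0 < \<epsilon>\<close> by (simp add: field_simps)
    then show "measure M A \<le> c * measure L A + \<epsilon>"
      using step[of "\<epsilon> / (c + 1)"] c \<open>0 < \<epsilon>\<close> by simp
  qed
qed

lemma measure_eqI_continuous:
  fixes M L :: "'a :: {second_countable_topology, complete_space} measure"
  assumes M: "finite_measure M" "sets M = sets borel"
    and L: "finite_measure L" "sets L = sets borel"
    and eq: "\<And>f :: 'a \<Rightarrow> real. continuous_on UNIV f \<Longrightarrow> (\<And>x. 0 \<le> f x) \<Longrightarrow> (\<And>x. f x \<le> 1) \<Longrightarrow>
        integral\<^sup>L M f = integral\<^sup>L L f"
  shows "M = L"
proof (rule measure_eqI)
  fix A assume "A \<in> sets M"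
  then have A: "A \<in> sets borel"
    using M by simp
  have le: "integral\<^sup>L M f \<le> 1 * integral\<^sup>L L f" "integral\<^sup>L L f \<le> 1 * integral\<^sup>L M f"
    if "continuous_on UNIV f" "\<And>x. 0 \<le> f x" "\<And>x. f x \<le> 1" for f :: "'a \<Rightarrow> real"
    using eq[OF that] by auto
  have "measure M A \<le> 1 * measure L A"
    by (rule measure_le_if_integral_le[OF M L _ le(1) A]) auto
  moreover have "measure L A \<le> 1 * measure M A"
    by (rule measure_le_if_integral_le[OF L M _ le(2) A]) auto
  ultimately have "measure M A = measure L A"
    by simp
  then show "emeasure M A = emeasure L A"
    using M L by (simp add: finite_measure.emeasure_eq_measure)
qed (use M L in simp)

lemma continuous_dense_L1:
  fixes L :: "'a :: {second_countable_topology, complete_space} measure" and f :: "'a \<Rightarrow> real"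
  assumes L: "finite_measure L" "sets L = sets borel"
    and f: "integrable L f" and "0 < \<epsilon>"
  shows "\<exists>g. continuous_on UNIV g \<and> bounded (range g) \<and> (\<integral>x. \<bar>f x - g x\<bar> \<partial>L) < \<epsilon>"
proof -
  interpret finite_measure L by fact
  have int: "integrable L g" if g: "continuous_on UNIV g" "bounded (range g)" for g :: "'a \<Rightarrow> real"
  proof -
    obtain B where "\<And>x. \<bar>g x\<bar> \<le> B"
      using g(2) by (auto simp: bounded_iff)
    then show ?thesis
      using borel_measurable_continuous_onI[OF g(1)] measurable_cong_sets[OF L(2) refl]
      by (intro integrable_const_bound[of _ B]) auto
  qed
  show ?thesis
    using f \<open>0 < \<epsilon>\<close>
  proof (induction f arbitrary: \<epsilon> rule: integrable_induct)
    case (base A c)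
    have A: "A \<in> sets borel" using base L by simp
    define \<delta> where "\<delta> = \<epsilon> / (2 * (\<bar>c\<bar> + 1))"
    have "\<delta> > 0" using base by (simp add: \<delta>_def)
    have \<delta>: "\<bar>c\<bar> * (2 * \<delta>) < \<epsilon>"
      using base by (simp add: \<delta>_def field_simps)
    obtain U where U: "open U" "A \<subseteq> U" "measure L U < measure L A + \<delta>"
      using outer_regular_open[OF L A \<open>\<delta> > 0\<close>] .
    obtain h :: "nat \<Rightarrow> 'a \<Rightarrow> real" where h: "\<And>n. continuous_on UNIV (h n)"
      "\<And>n x. 0 \<le> h n x" "\<And>n x. h n x \<le> 1" "\<And>x. (\<lambda>n. h n x) \<longlonglongrightarrow> indicator U x"
      using open_indicator_limit[OF U(1)] by metis
    have bh: "bounded (range (h n))" for n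
      using h by (auto simp: bounded_iff intro!: exI[of _ 1])
    have [measurable]: "h n \<in> borel_measurable L" "A \<in> sets L" "U \<in> sets L" for n
      using int[OF h(1) bh] base(1) U L(2) by auto
    have "(\<lambda>n. \<integral>x. \<bar>indicator U x - h n x\<bar> \<partial>L) \<longlonglongrightarrow> (\<integral>x. \<bar>indicator U x - indicator U x\<bar> \<partial>L)"
      using h by (intro integral_dominated_convergence[where w = "\<lambda>_. 1"] tendsto_intros AE_I2)
         (auto simp: indicator_def)
    then have "eventually (\<lambda>n. (\<integral>x. \<bar>indicator U x - h n x\<bar> \<partial>L) < \<delta>) sequentially"
      using \<open>\<delta> > 0\<close> by (intro order_tendstoD(2)[where y = 0]) auto
    then obtain n where n: "(\<integral>x. \<bar>indicator U x - h n x\<bar> \<partial>L) < \<delta>"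
      by (auto simp: eventually_sequentially)
    have hn: "integrable L (h n)"
      by (rule int[OF h(1) bh])
    have ind: "integrable L (indicat_real B)" if "B \<in> sets L" for B
      using that by (simp add: less_top[symmetric])
    have i1: "integrable L (\<lambda>x. \<bar>c\<bar> * \<bar>indicator A x - h n x\<bar>)"
      using ind[of A] hn by (intro integrable_mult_right integrable_abs integrable_diff) auto
    have i2: "integrable L (\<lambda>x. \<bar>indicator U x - h n x\<bar>)"
      using ind[of U] hn by (intro integrable_abs integrable_diff) auto
    have i3: "integrable L (\<lambda>x. \<bar>c\<bar> * (indicator (U - A) x + \<bar>indicator U x - h n x\<bar>))"
      using ind[of "U - A"] i2 by (intro integrable_mult_right integrable_add) auto
    have "(\<integral>x. \<bar>indicator A x *\<^sub>R c - c * h n x\<bar> \<partial>L) =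
        (\<integral>x. \<bar>c\<bar> * \<bar>indicator A x - h n x\<bar> \<partial>L)"
      by (simp add: abs_mult[symmetric] right_diff_distrib mult.commute)
    also have "\<dots> \<le> (\<integral>x. \<bar>c\<bar> * (indicator (U - A) x + \<bar>indicator U x - h n x\<bar>) \<partial>L)"
      using U(2) by (intro integral_mono i1 i3 mult_left_mono) (auto simp: indicator_def)
    also have "\<dots> = \<bar>c\<bar> * (measure L (U - A) + (\<integral>x. \<bar>indicator U x - h n x\<bar> \<partial>L))"
      using ind[of "U - A"] i2 by simp
    also have "measure L (U - A) = measure L U - measure L A"
      using U by (intro finite_measure_Diff) auto
    also have "\<bar>c\<bar> * (measure L U - measure L A + (\<integral>x. \<bar>indicator U x - h n x\<bar> \<partial>L)) \<le> \<bar>c\<bar> * (2 * \<delta>)"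
      using U n by (intro mult_left_mono) auto
    also have "\<dots> < \<epsilon>" by (rule \<delta>)
    finally have "(\<integral>x. \<bar>indicator A x *\<^sub>R c - c * h n x\<bar> \<partial>L) < \<epsilon>" .
    moreover have "\<bar>c * h n x\<bar> \<le> \<bar>c\<bar>" for x
      using h(2,3) by (simp add: abs_mult mult_left_le)
    then have "bounded (range (\<lambda>x. c * h n x))"
      by (auto simp: bounded_iff intro!: exI[of _ "\<bar>c\<bar>"])
    moreover have "continuous_on UNIV (\<lambda>x. c * h n x)"
      by (intro continuous_intros h)
    ultimately show ?case by blast
  next
    case (add f g)
    obtain f' where f': "continuous_on UNIV f'" "bounded (range f')" "(\<integral>x. \<bar>f x - f' x\<bar> \<partial>L) < \<epsilon> / 2"
      using add.IH(1)[of "\<epsilon> / 2"] add.prems by auto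
    obtain g' where g': "continuous_on UNIV g'" "bounded (range g')" "(\<integral>x. \<bar>g x - g' x\<bar> \<partial>L) < \<epsilon> / 2"
      using add.IH(2)[of "\<epsilon> / 2"] add.prems by auto
    have "(\<integral>x. \<bar>f x + g x - (f' x + g' x)\<bar> \<partial>L) \<le> (\<integral>x. \<bar>f x - f' x\<bar> + \<bar>g x - g' x\<bar> \<partial>L)"
      using add.hyps int f' g'
      by (intro integral_mono integrable_abs integrable_diff integrable_add) auto
    also have "\<dots> = (\<integral>x. \<bar>f x - f' x\<bar> \<partial>L) + (\<integral>x. \<bar>g x - g' x\<bar> \<partial>L)"
      using add.hyps int f' g' by (intro Bochner_Integration.integral_add) auto
    also have "\<dots> < \<epsilon>" using f' g' by simp
    finally show ?case
      using f' g' by (intro exI[of _ "\<lambda>x. f' x + g' x"] conjI)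
        (auto intro!: continuous_intros bounded_plus_comp)
  next
    case (lim f s)
    have "(\<lambda>i. \<integral>x. \<bar>f x - s i x\<bar> \<partial>L) \<longlonglongrightarrow> (\<integral>x. \<bar>f x - f x\<bar> \<partial>L)"
    proof (rule integral_dominated_convergence[where w = "\<lambda>x. 3 * \<bar>f x\<bar>"])
      show "AE x in L. norm \<bar>f x - s i x\<bar> \<le> 3 * \<bar>f x\<bar>" for i
        using lim.hyps(3)[of _ i] by (intro AE_I2) force
      show "AE x in L. (\<lambda>i. \<bar>f x - s i x\<bar>) \<longlonglongrightarrow> \<bar>f x - f x\<bar>"
        by (intro AE_I2 tendsto_intros lim.hyps)
    qed (use lim.hyps in auto)
    then have "eventually (\<lambda>i. (\<integral>x. \<bar>f x - s i x\<bar> \<partial>L) < \<epsilon> / 2) sequentially"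
      using lim.prems by (intro order_tendstoD(2)[where y = 0]) auto
    then obtain i where i: "(\<integral>x. \<bar>f x - s i x\<bar> \<partial>L) < \<epsilon> / 2"
      by (auto simp: eventually_sequentially)
    obtain g where g: "continuous_on UNIV g" "bounded (range g)" "(\<integral>x. \<bar>s i x - g x\<bar> \<partial>L) < \<epsilon> / 2"
      using lim.IH[of "\<epsilon> / 2" i] lim.prems by auto
    have "(\<integral>x. \<bar>f x - g x\<bar> \<partial>L) \<le> (\<integral>x. \<bar>f x - s i x\<bar> + \<bar>s i x - g x\<bar> \<partial>L)"
      using lim.hyps int g
      by (intro integral_mono integrable_abs integrable_diff integrable_add) auto
    also have "\<dots> = (\<integral>x. \<bar>f x - s i x\<bar> \<partial>L) + (\<integral>x. \<bar>s i x - g x\<bar> \<partial>L)"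
      using lim.hyps int g by (intro Bochner_Integration.integral_add) auto
    also have "\<dots> < \<epsilon>" using i g by simp
    finally show ?case using g by blast
  qed
qed

text \<open>Clamping to an interval that contains almost all values keeps continuity and does not increase
  the distance.\<close>

lemma continuous_dense_L1_bounded:
  fixes L :: "'a :: {second_countable_topology, complete_space} measure" and f :: "'a \<Rightarrow> real"
  assumes L: "finite_measure L" "sets L = sets borel"
    and f: "integrable L f" "AE x in L. 0 \<le> f x" "AE x in L. f x \<le> B" and "0 \<le> B" "0 < \<epsilon>"
  obtains g where "continuous_on UNIV g" "\<And>x. 0 \<le> g x" "\<And>x. g x \<le> B"
    "(\<integral>x. \<bar>f x - g x\<bar> \<partial>L) < \<epsilon>"
proof -
  interpret finite_measure L by fact
  obtain g where g: "continuous_on UNIV g" "bounded (range g)" "(\<integral>x. \<bar>f x - g x\<bar> \<partial>L) < \<epsilon>"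
    using continuous_dense_L1[OF L f(1) \<open>0 < \<epsilon>\<close>] by blast
  define h where "h x = max 0 (min B (g x))" for x
  have h: "continuous_on UNIV h"
    unfolding h_def using g by (intro continuous_intros)
  have [measurable]: "g \<in> borel_measurable L" "h \<in> borel_measurable L" "f \<in> borel_measurable L"
    using g h f borel_measurable_continuous_onI measurable_cong_sets[OF L(2) refl] by blast+
  have "integrable L h"
    using \<open>0 \<le> B\<close> by (intro integrable_const_bound[of _ B]) (auto simp: h_def)
  moreover obtain C where "\<And>x. \<bar>g x\<bar> \<le> C"
    using g(2) by (auto simp: bounded_iff)
  then have "integrable L g"
    by (intro integrable_const_bound[of _ C]) auto
  ultimately have "(\<integral>x. \<bar>f x - h x\<bar> \<partial>L) \<le> (\<integral>x. \<bar>f x - g x\<bar> \<partial>L)"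
    using f by (intro integral_mono_AE) (auto simp: h_def)
  then show thesis
    using g h \<open>0 \<le> B\<close> by (intro that[of h]) (auto simp: h_def)
qed

section \<open>Limit measures of good sets\<close>

lemma avg_trig_poly_convergent:
  fixes a :: "nat \<Rightarrow> complex"
  assumes conv: "\<And>k :: int. convergent (avg (\<lambda>n. a n * e (of_int k * x n)))"
    and f: "trig_poly f"
  shows "convergent (avg (\<lambda>n. a n * of_real (f (to_circle (x n)))))"
  using f
proof induction
  case (monom c k)
  have "a n * of_real (Re (c * circle_emb (to_circle (x n)) ^ k)) =
      c / 2 * (a n * e (of_int (int k) * x n)) + cnj c / 2 * (a n * e (of_int (- int k) * x n))" for n
  proof -
    have re: "complex_of_real (Re z) = z / 2 + cnj z / 2" for z
      using complex_add_cnj[of z] by (simp add: field_simps)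
    show ?thesis
      unfolding re by (simp add: e_power cnj_e distrib_left mult.left_commute)
  qed
  moreover have "convergent (\<lambda>N. c / 2 * avg (\<lambda>n. a n * e (of_int (int k) * x n)) N +
      cnj c / 2 * avg (\<lambda>n. a n * e (of_int (- int k) * x n)) N)"
    by (intro convergent_add convergent_mult conv convergent_const)
  ultimately show ?case
    by (simp only: avg_add avg_mult_left)
next
  case (add f g)
  then have "convergent (\<lambda>N. avg (\<lambda>n. a n * of_real (f (to_circle (x n)))) N +
      avg (\<lambda>n. a n * of_real (g (to_circle (x n)))) N)"
    by (intro convergent_add)
  then show ?case
    by (simp add: distrib_left avg_add)
qed

text \<open>The weights \<open>a n\<close> make this usable simultaneously for the frequency under which the limit
  measure is formed and for all the frequencies in the definition of a good set.\<close>

lemma avg_continuous_convergent: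
  fixes a :: "nat \<Rightarrow> complex"
  assumes conv: "\<And>k :: int. convergent (avg (\<lambda>n. a n * e (of_int k * x n)))"
    and bound: "\<And>n. norm (a n) \<le> 1"
    and f: "continuous_on UNIV f"
  shows "convergent (avg (\<lambda>n. a n * of_real (f (to_circle (x n)))))"
proof -
  have "\<exists>g. trig_poly g \<and> (\<forall>z. \<bar>f z - g z\<bar> < 1 / real (Suc i))" for i
    using trig_poly_dense[OF f, of "1 / real (Suc i)"] by (metis divide_pos_pos of_nat_0_less_iff zero_less_Suc zero_less_one)
  then obtain g where g: "\<And>i. trig_poly (g i)" "\<And>i z. \<bar>f z - g i z\<bar> < 1 / real (Suc i)"
    by metis
  have "\<exists>l. avg (\<lambda>n. a n * of_real (g i (to_circle (x n)))) \<longlonglongrightarrow> l" for i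
    using avg_trig_poly_convergent[OF conv g(1)] by (simp add: convergent_def)
  then obtain l where l: "\<And>i. avg (\<lambda>n. a n * of_real (g i (to_circle (x n)))) \<longlonglongrightarrow> l i"
    by metis
  have close: "eventually (\<lambda>N. avg (\<lambda>n. norm (a n * of_real (f (to_circle (x n))) -
      a n * of_real (g i (to_circle (x n))))) N \<le> 1 / real (Suc i)) sequentially" for i
  proof (intro always_eventually allI avg_le_bound)
    fix n
    have "norm (a n * of_real (f (to_circle (x n))) - a n * of_real (g i (to_circle (x n)))) =
        norm (a n) * \<bar>f (to_circle (x n)) - g i (to_circle (x n))\<bar>"
      by (metis norm_mult norm_of_real of_real_diff right_diff_distrib)
    also have "\<dots> \<le> 1 * (1 / real (Suc i))"
      using bound[of n] g(2)[of "to_circle (x n)" i] by (intro mult_mono) auto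
    finally show "norm (a n * of_real (f (to_circle (x n))) - a n * of_real (g i (to_circle (x n))))
        \<le> 1 / real (Suc i)"
      by simp
  qed simp
  have lim: "(\<lambda>i. 1 / real (Suc i)) \<longlonglongrightarrow> 0"
    by real_asymp
  obtain L where "avg (\<lambda>n. a n * of_real (f (to_circle (x n)))) \<longlonglongrightarrow> L"
    by (rule avg_convergent_approx[OF l lim close])
  then show ?thesis
    by (auto simp: convergent_def)
qed

lemma measurable_continuous_circle:
  fixes f :: "circle \<Rightarrow> 'b :: real_normed_vector"
  assumes "continuous_on UNIV f" "sets L = sets borel"
  shows "f \<in> borel_measurable L"
  by (subst measurable_cong_sets[OF assms(2) refl]) (rule borel_measurable_continuous_onI[OF assms(1)])

lemma integrable_continuous_circle:
  fixes f :: "circle \<Rightarrow> real"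
  assumes "finite_measure L" "sets L = sets borel" "continuous_on UNIV f"
  shows "integrable L f"
proof -
  interpret finite_measure L by fact
  obtain B where "\<And>x. \<bar>f x\<bar> \<le> B"
    using bounded_continuous_circle[OF assms(3)] by blast
  then show ?thesis
    using measurable_continuous_circle[OF assms(3,2)] by (intro integrable_const_bound[of _ B]) auto
qed

text \<open>On the real line, representatives in \<open>[0, 1)\<close> form a tight sequence of measures, so Helly's
  selection theorem provides a subsequential limit; the averages already converge, so it is the
  limit of the whole sequence.\<close>

lemma ex_limit_measure:
  fixes x :: "nat \<Rightarrow> real"
  assumes conv: "\<And>f. continuous_on UNIV f \<Longrightarrow> convergent (avg (\<lambda>n. f (to_circle (x n)) :: real))"
  obtains L where "sets L = sets borel" "prob_space L"
    "\<And>f :: circle \<Rightarrow> real. continuous_on UNIV f \<Longrightarrow>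
        avg (\<lambda>n. f (to_circle (x n))) \<longlonglongrightarrow> integral\<^sup>L L f"
proof -
  define \<mu> where "\<mu> N = distr (uniform_count_measure {..<Suc N}) borel (\<lambda>n. frac (x n))" for N
  have meas: "(\<lambda>n. frac (x n)) \<in> borel_measurable (uniform_count_measure {..<Suc N})" for N
    by (simp add: measurable_def space_uniform_count_measure sets_uniform_count_measure Pi_def)
  have prob: "prob_space (uniform_count_measure {..<Suc N})" for N
    by (rule prob_space_uniform_count_measure) auto
  have rd: "real_distribution (\<mu> N)" for N
    unfolding \<mu>_def using prob_space.real_distribution_distr[OF prob meas] .
  have "measure (\<mu> N) {-1<..1} = 1" for N
  proof -
    interpret prob_space "uniform_count_measure {..<Suc N}" by (rule prob)
    have "(\<lambda>n. frac (x n)) -` {-1<..1} \<inter> space (uniform_count_measure {..<Suc N})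
        = space (uniform_count_measure {..<Suc N})"
    proof -
      have "-1 < frac t" "frac t \<le> 1" for t :: real
        using frac_ge_0[of t] frac_lt_1[of t] by linarith+
      then show ?thesis by auto
    qed
    then show ?thesis
      unfolding \<mu>_def using meas[of N] prob_space by (subst measure_distr) auto
  qed
  then have "(-1 :: real) < 1 \<and> (\<forall>N. 1 - \<epsilon> < measure (\<mu> N) {-1<..1})" if "0 < \<epsilon>" for \<epsilon>
    using that by simp
  then have "tight \<mu>"
    unfolding tight_def using rd by blast
  then obtain r M where r: "strict_mono r" and M: "real_distribution M"
    and weak: "weak_conv_m (\<mu> \<circ> id \<circ> r) M"
    using tight_imp_convergent_subsubsequence[of \<mu> id] by (auto simp: strict_mono_def)
  interpret M: real_distribution M by fact
  define L where "L = distr M borel to_circle"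
  have [measurable]: "to_circle \<in> borel_measurable borel"
    by (rule borel_measurable_continuous_onI[OF continuous_to_circle])
  have lim: "avg (\<lambda>n. f (to_circle (x n))) \<longlonglongrightarrow> integral\<^sup>L L f" if f: "continuous_on UNIV f"
    for f :: "circle \<Rightarrow> real"
  proof -
    have [measurable]: "f \<in> borel_measurable borel"
      by (rule borel_measurable_continuous_onI[OF f])
    have cont: "continuous_on UNIV (\<lambda>t. f (to_circle t))"
      using continuous_on_compose2[OF f continuous_to_circle] by simp
    obtain B where B: "\<And>z. \<bar>f z\<bar> \<le> B"
      using bounded_continuous_circle[OF f] by blast
    have "(\<lambda>n. integral\<^sup>L ((\<mu> \<circ> id \<circ> r) n) (\<lambda>t. f (to_circle t))) \<longlonglongrightarrow> (\<integral>t. f (to_circle t) \<partial>M)"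
      using cont B rd
      by (intro weak_conv_imp_integral_bdd_continuous_conv[OF _ M weak])
         (auto simp: continuous_on_eq_continuous_at)
    also have "(\<integral>t. f (to_circle t) \<partial>M) = integral\<^sup>L L f"
      unfolding L_def by (rule integral_distr[symmetric]) auto
    also have "(\<lambda>n. integral\<^sup>L ((\<mu> \<circ> id \<circ> r) n) (\<lambda>t. f (to_circle t))) =
        (\<lambda>n. avg (\<lambda>n. f (to_circle (x n))) (Suc (r n)))"
    proof
      fix n
      have "integral\<^sup>L (\<mu> (r n)) (\<lambda>t. f (to_circle t)) =
          (\<integral>i. f (to_circle (frac (x i))) \<partial>uniform_count_measure {..<Suc (r n)})"
        unfolding \<mu>_def by (rule integral_distr[OF meas]) measurable
      also have "\<dots> = avg (\<lambda>n. f (to_circle (x n))) (Suc (r n))"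
        by (simp add: integral_uniform_count_measure to_circle_frac avg_def)
      finally show "integral\<^sup>L ((\<mu> \<circ> id \<circ> r) n) (\<lambda>t. f (to_circle t)) =
          avg (\<lambda>n. f (to_circle (x n))) (Suc (r n))" by simp
    qed
    finally have 1: "(\<lambda>n. avg (\<lambda>n. f (to_circle (x n))) (Suc (r n))) \<longlonglongrightarrow> integral\<^sup>L L f" .
    obtain l where l: "avg (\<lambda>n. f (to_circle (x n))) \<longlonglongrightarrow> l"
      using conv[OF f] by (auto simp: convergent_def)
    then have "(\<lambda>n. avg (\<lambda>n. f (to_circle (x n))) (Suc (r n))) \<longlonglongrightarrow> l"
      using LIMSEQ_subseq_LIMSEQ[OF l, of "\<lambda>n. Suc (r n)"] r
      by (simp add: strict_mono_def o_def)
    then have "l = integral\<^sup>L L f"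
      using 1 by (rule LIMSEQ_unique)
    with l show ?thesis
      by simp
  qed
  have "sets L = sets borel" "prob_space L"
    by (auto simp: L_def intro!: M.prob_space_distr)
  then show thesis
    using lim by (rule that)
qed

abbreviation orbit :: "nat set \<Rightarrow> real \<Rightarrow> nat \<Rightarrow> circle" where
  "orbit S \<beta> n \<equiv> to_circle (real (enumerate S n) * \<beta>)"

lemma integral_empirical_measure:
  fixes f :: "circle \<Rightarrow> real"
  assumes "continuous_on UNIV f"
  shows "integral\<^sup>L (empirical_measure S \<beta> N) f = avg (\<lambda>n. f (orbit S \<beta> n)) N"
proof -
  have "(\<lambda>n. to_circle (real (enumerate S (n - 1)) * \<beta>)) \<in> borel_measurable (uniform_count_measure {1..N})"
    by (auto simp: measurable_def space_uniform_count_measure sets_uniform_count_measure)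
  then have "integral\<^sup>L (empirical_measure S \<beta> N) f =
      (\<integral>n. f (orbit S \<beta> (n - 1)) \<partial>uniform_count_measure {1..N})"
    unfolding empirical_measure_def
    using borel_measurable_continuous_onI[OF assms] by (rule integral_distr)
  also have "\<dots> = avg (\<lambda>n. f (orbit S \<beta> n)) N"
    by (simp add: integral_uniform_count_measure avg_def sum.atLeast1_atMost_eq)
  finally show ?thesis .
qed

lemma good_iff_avg:
  "good S \<longleftrightarrow> S \<subseteq> {1..} \<and> infinite S \<and>
     (\<forall>\<beta>. convergent (avg (\<lambda>n. e (real (enumerate S n) * \<beta>))))"
proof -
  have "(\<lambda>N. (1 / of_nat N) * (\<Sum>n = 1..N. e (real (enumerate S (n - 1)) * \<beta>))) =
      avg (\<lambda>n. e (real (enumerate S n) * \<beta>))" for \<beta>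
    by (rule ext) (simp add: avg_def sum.atLeast1_atMost_eq scaleR_conv_of_real)
  then show ?thesis
    by (simp add: good_def)
qed

lemma good_avg_continuous_convergent:
  assumes "good S" "continuous_on UNIV f"
  shows "convergent (avg (\<lambda>n. e (real (enumerate S n) * \<beta>) * of_real (f (orbit S \<alpha> n))))"
proof -
  have "e (real (enumerate S n) * \<beta>) * e (of_int k * (real (enumerate S n) * \<alpha>)) =
      e (real (enumerate S n) * (\<beta> + of_int k * \<alpha>))" for n and k :: int
    by (simp add: e_add[symmetric] algebra_simps)
  then have "convergent (avg (\<lambda>n. e (real (enumerate S n) * \<beta>) *
      e (of_int k * (real (enumerate S n) * \<alpha>))))" for k :: int
    using assms(1) by (simp add: good_iff_avg)
  from avg_continuous_convergent[OF this _ assms(2)] show ?thesis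
    by simp
qed

lemma limit_measure_eqI:
  assumes L: "sets L = sets borel" "prob_space L"
    and lim: "\<And>f :: circle \<Rightarrow> real. continuous_on UNIV f \<Longrightarrow>
        avg (\<lambda>n. f (orbit S \<beta> n)) \<longlonglongrightarrow> integral\<^sup>L L f"
  shows "limit_measure S \<beta> = L"
  unfolding limit_measure_def
proof (rule the_equality)
  show "sets L = sets borel \<and> prob_space L \<and> weakly_converges (empirical_measure S \<beta>) L"
    unfolding weakly_converges_def using L lim
    by (intro conjI allI impI) (simp_all add: integral_empirical_measure)
next
  fix L' :: "circle measure"
  assume L': "sets L' = sets borel \<and> prob_space L' \<and> weakly_converges (empirical_measure S \<beta>) L'"
  show "L' = L"
  proof (rule measure_eqI_continuous)
    fix f :: "circle \<Rightarrow> real" assume f: "continuous_on UNIV f"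
    then have "bounded (range f)"
      using compact_imp_bounded[OF compact_continuous_image[OF f compact_circle]] by simp
    then have "avg (\<lambda>n. f (orbit S \<beta> n)) \<longlonglongrightarrow> integral\<^sup>L L' f"
      using L' f by (simp add: weakly_converges_def integral_empirical_measure)
    then show "integral\<^sup>L L' f = integral\<^sup>L L f"
      by (rule LIMSEQ_unique) (rule lim[OF f])
  next
    show "finite_measure L'" "finite_measure L"
      using L L' by (simp_all add: prob_space.finite_measure)
  qed (use L L' in simp_all)
qed

lemma
  fixes f :: "circle \<Rightarrow> real"
  assumes "good S"
  shows sets_limit_measure: "sets (limit_measure S \<beta>) = sets borel"
    and prob_space_limit_measure: "prob_space (limit_measure S \<beta>)"
    and limit_measure_tendsto: "continuous_on UNIV f \<Longrightarrow>
          avg (\<lambda>n. f (orbit S \<beta> n)) \<longlonglongrightarrow> integral\<^sup>L (limit_measure S \<beta>) f"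
proof -
  have "convergent (avg (\<lambda>n. f (orbit S \<beta> n)))" if "continuous_on UNIV f" for f :: "circle \<Rightarrow> real"
  proof -
    have "convergent (\<lambda>N. Re (avg (\<lambda>n. of_real (f (orbit S \<beta> n))) N))"
      using good_avg_continuous_convergent[OF assms that, of 0 \<beta>]
      by (auto simp: convergent_def intro: tendsto_Re)
    then show ?thesis
      by (simp flip: avg_bounded_linear[OF bounded_linear_Re])
  qed
  then obtain L where L: "sets L = sets borel" "prob_space L"
    "\<And>f :: circle \<Rightarrow> real. continuous_on UNIV f \<Longrightarrow>
        avg (\<lambda>n. f (orbit S \<beta> n)) \<longlonglongrightarrow> integral\<^sup>L L f"
    using ex_limit_measure[of "\<lambda>n. real (enumerate S n) * \<beta>"] by metis
  then have eq: "limit_measure S \<beta> = L"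
    by (rule limit_measure_eqI)
  show "sets (limit_measure S \<beta>) = sets borel" "prob_space (limit_measure S \<beta>)"
    unfolding eq by (rule L(1), rule L(2))
  show "avg (\<lambda>n. f (orbit S \<beta> n)) \<longlonglongrightarrow> integral\<^sup>L (limit_measure S \<beta>) f"
    if "continuous_on UNIV f"
    unfolding eq by (rule L(3)[OF that])
qed

text \<open>Trigonometric polynomials are uniformly dense in the continuous functions, so the Fourier
  coefficients determine the integrals of all continuous functions.\<close>

lemma measure_eqI_trig:
  assumes M: "prob_space M" "sets M = sets borel"
    and L: "prob_space L" "sets L = sets borel"
    and eq: "\<And>c k. (\<integral>x. Re (c * circle_emb x ^ k) \<partial>M) = (\<integral>x. Re (c * circle_emb x ^ k) \<partial>L)"
  shows "M = L"
proof -
  interpret M: prob_space M by fact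
  interpret L: prob_space L by fact
  note int = integrable_continuous_circle[OF M.finite_measure_axioms M(2)]
    integrable_continuous_circle[OF L.finite_measure_axioms L(2)]
  have trig: "integral\<^sup>L M g = integral\<^sup>L L g" if "trig_poly g" for g
    using that
  proof induction
    case (monom c k)
    show ?case by (rule eq)
  qed (simp add: int trig_poly_continuous)
  show ?thesis
  proof (rule measure_eqI_continuous[OF M.finite_measure_axioms M(2) L.finite_measure_axioms L(2)])
    fix f :: "circle \<Rightarrow> real" assume f: "continuous_on UNIV f"
    have "\<bar>integral\<^sup>L M f - integral\<^sup>L L f\<bar> \<le> \<epsilon>" if "\<epsilon> > 0" for \<epsilon>
    proof -
      obtain g where g: "trig_poly g" "\<And>x. \<bar>f x - g x\<bar> < \<epsilon> / 2"
        using trig_poly_dense[OF f, of "\<epsilon> / 2"] \<open>\<epsilon> > 0\<close> by auto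
      note g' = trig_poly_continuous[OF g(1)]
      have close: "\<bar>integral\<^sup>L N f - integral\<^sup>L N g\<bar> \<le> \<epsilon> / 2"
        if N: "prob_space N" "sets N = sets borel" for N
      proof -
        interpret N: prob_space N by (rule N)
        have fg: "integrable N f" "integrable N g"
          by (rule integrable_continuous_circle[OF N.finite_measure_axioms N(2)], fact)+
        have "\<bar>integral\<^sup>L N f - integral\<^sup>L N g\<bar> = \<bar>\<integral>x. f x - g x \<partial>N\<bar>"
          using fg by simp
        also have "\<dots> \<le> (\<integral>x. \<bar>f x - g x\<bar> \<partial>N)"
          by (rule integral_abs_bound)
        also have "\<dots> \<le> (\<integral>x. \<epsilon> / 2 \<partial>N)"
          using fg g(2) by (intro integral_mono) (auto intro: less_imp_le)
        finally show ?thesis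
          by (simp add: N.prob_space)
      qed
      show ?thesis
        using close[OF M] close[OF L] trig[OF g(1)] by linarith
    qed
    then have "\<bar>integral\<^sup>L M f - integral\<^sup>L L f\<bar> \<le> 0"
      by (rule dense_ge)
    then show "integral\<^sup>L M f = integral\<^sup>L L f"
      by simp
  qed
qed

section \<open>Random selection\<close>

definition selection_space :: "(nat \<Rightarrow> real) \<Rightarrow> (nat \<Rightarrow> bool) measure" where
  "selection_space p = (\<Pi>\<^sub>M n\<in>UNIV. measure_pmf (bernoulli_pmf (p n)))"

lemma prob_space_selection_space: "prob_space (selection_space p)"
  unfolding selection_space_def by (intro prob_space_PiM prob_space_measure_pmf)

lemma measurable_selection [measurable]:
  "(\<lambda>\<omega>. h (\<omega> n)) \<in> borel_measurable (selection_space p)"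
  for h :: "bool \<Rightarrow> 'b :: topological_space"
proof (rule measurable_compose[where g = h and N = "count_space UNIV"])
  have "(\<lambda>\<omega>. \<omega> n) \<in> selection_space p \<rightarrow>\<^sub>M measure_pmf (bernoulli_pmf (p n))"
    unfolding selection_space_def by (rule measurable_component_singleton) simp
  then show "(\<lambda>\<omega>. \<omega> n) \<in> selection_space p \<rightarrow>\<^sub>M count_space UNIV"
    by simp
qed simp

lemma distr_selection:
  "distr (selection_space p) (measure_pmf (bernoulli_pmf (p n))) (\<lambda>\<omega>. \<omega> n) =
     measure_pmf (bernoulli_pmf (p n))"
  unfolding selection_space_def
  by (rule distr_PiM_component) (auto intro: prob_space_measure_pmf)

lemma indep_selection:
  "prob_space.indep_vars (selection_space p) (\<lambda>n. measure_pmf (bernoulli_pmf (p n))) (\<lambda>n \<omega>. \<omega> n) UNIV"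
proof -
  interpret prob_space "selection_space p" by (rule prob_space_selection_space)
  have "distr (selection_space p) (\<Pi>\<^sub>M n\<in>UNIV. measure_pmf (bernoulli_pmf (p n))) (\<lambda>\<omega>. \<lambda>n\<in>UNIV. \<omega> n) =
      selection_space p"
    by (simp add: selection_space_def restrict_def distr_id)
  also have "\<dots> = (\<Pi>\<^sub>M n\<in>UNIV. distr (selection_space p) (measure_pmf (bernoulli_pmf (p n))) (\<lambda>\<omega>. \<omega> n))"
    by (simp only: distr_selection) (simp add: selection_space_def)
  finally show ?thesis
    by (subst indep_vars_iff_distr_eq_PiM')
       (auto simp: selection_space_def intro!: measurable_component_singleton)
qed

lemma selection_deviation:
  fixes c p :: "nat \<Rightarrow> real"
  assumes p: "\<And>n. 0 \<le> p n" "\<And>n. p n \<le> 1" and c: "\<And>n. \<bar>c n\<bar> \<le> 1"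
    and "0 < \<epsilon>" "0 < N"
  shows "measure (selection_space p)
      {\<omega> \<in> space (selection_space p). \<epsilon> * real N \<le> \<bar>\<Sum>n<N. (of_bool (\<omega> n) - p n) * c n\<bar>}
    \<le> 2 * exp (- (\<epsilon>\<^sup>2 * real N / 2))"
proof -
  interpret prob_space "selection_space p" by (rule prob_space_selection_space)
  have indep: "indep_vars (\<lambda>_. borel) (\<lambda>n \<omega>. of_bool (\<omega> n) * c n) {..<N}"
    using indep_vars_compose2[OF indep_vars_subset[OF indep_selection[of p], of "{..<N}"],
        of "\<lambda>n b. of_bool b * c n" "\<lambda>_. borel"] by simp
  have exp: "expectation (\<lambda>\<omega>. of_bool (\<omega> n) * c n) = p n * c n" for n
  proof -
    have "expectation (\<lambda>\<omega>. of_bool (\<omega> n) * c n) =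
        (\<integral>b. of_bool b * c n \<partial>distr (selection_space p) (measure_pmf (bernoulli_pmf (p n))) (\<lambda>\<omega>. \<omega> n))"
      by (intro integral_distr[symmetric])
        (auto simp: selection_space_def intro!: measurable_component_singleton)
    also have "\<dots> = p n * c n"
      unfolding distr_selection using p by simp
    finally show ?thesis .
  qed
  interpret Hoeffding_ineq "selection_space p" "{..<N}" "\<lambda>n \<omega>. of_bool (\<omega> n) * c n"
    "\<lambda>_. -1" "\<lambda>_. 1" "\<Sum>n<N. p n * c n"
  proof unfold_locales
    show "AE \<omega> in selection_space p. of_bool (\<omega> n) * c n \<in> {- 1..1}" for n
      using c[of n] by (intro AE_I2) (auto simp: abs_le_iff)
    show "(\<Sum>n<N. p n * c n) \<equiv> (\<Sum>n<N. expectation (\<lambda>\<omega>. of_bool (\<omega> n) * c n))"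
      by (simp only: exp)
  qed (auto intro: indep)
  have "{\<omega> \<in> space (selection_space p). \<epsilon> * real N \<le> \<bar>\<Sum>n<N. (of_bool (\<omega> n) - p n) * c n\<bar>} =
      {\<omega> \<in> space (selection_space p). \<bar>(\<Sum>n<N. of_bool (\<omega> n) * c n) - (\<Sum>n<N. p n * c n)\<bar> \<ge> \<epsilon> * real N}"
    by (simp add: sum_subtractf left_diff_distrib)
  also have "prob \<dots> \<le> 2 * exp (-2 * (\<epsilon> * real N)\<^sup>2 / (\<Sum>n<N. (1 - (-1 :: real))\<^sup>2))"
    using assms by (intro Hoeffding_ineq_abs_ge) auto
  also have "-2 * (\<epsilon> * real N)\<^sup>2 / (\<Sum>n<N. (1 - (-1 :: real))\<^sup>2) = - (\<epsilon>\<^sup>2 * real N / 2)"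
    using \<open>0 < N\<close> by (simp add: field_simps power2_eq_square)
  finally show ?thesis .
qed

text \<open>The exponential sum with frequency \<open>\<beta>\<close> varies by at most \<open>2 * pi\<close> when \<open>\<beta>\<close>, taken
  modulo 1, is rounded down to a multiple of \<open>1 / (N * r N)\<close>: each of the \<open>N\<close> terms moves by at most
  \<open>2 * pi / N\<close>. So finitely many frequencies control all.\<close>

lemma exp_sum_grid:
  fixes r :: "nat \<Rightarrow> nat" and d :: "nat \<Rightarrow> real"
  assumes r: "mono r" "0 < r N" and d: "\<And>n. \<bar>d n\<bar> \<le> 1" and "0 < N"
    and Q: "Q = N * r N"
    and grid: "\<And>j. j < Q \<Longrightarrow> \<bar>\<Sum>n<N. d n * Re (e (real (r n) * (real j / real Q)))\<bar> \<le> \<epsilon> * real N"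
      "\<And>j. j < Q \<Longrightarrow> \<bar>\<Sum>n<N. d n * Im (e (real (r n) * (real j / real Q)))\<bar> \<le> \<epsilon> * real N"
  shows "norm (avg (\<lambda>n. of_real (d n) * e (real (r n) * \<beta>)) N) \<le> 2 * \<epsilon> + 2 * pi / real N"
proof -
  have "Q > 0" using Q r \<open>0 < N\<close> by simp
  define t where "t = frac \<beta>"
  have t: "0 \<le> t" "t < 1"
    by (auto simp: t_def frac_lt_1)
  have e_t: "e (real (r n) * \<beta>) = e (real (r n) * t)" for n
  proof -
    have "real (r n) * \<beta> - real (r n) * t = real (r n) * of_int \<lfloor>\<beta>\<rfloor>"
      by (simp add: t_def frac_def algebra_simps)
    then show ?thesis
      unfolding e_eq_iff by simp
  qed
  define j where "j = nat \<lfloor>t * real Q\<rfloor>"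
  have j: "real j \<le> t * real Q" "t * real Q < real j + 1"
    using t by (auto simp: j_def)
  have "t * real Q < 1 * real Q"
    using t \<open>Q > 0\<close> by (intro mult_strict_right_mono) auto
  with j(1) have "j < Q" by simp
  have near: "\<bar>t - real j / real Q\<bar> \<le> 1 / real Q"
  proof -
    have "t - real j / real Q = (t * real Q - real j) / real Q"
      using \<open>Q > 0\<close> by (simp add: field_simps)
    then show ?thesis
      using j by (auto simp: abs_divide intro!: divide_right_mono)
  qed
  let ?z = "\<Sum>n<N. of_real (d n) * e (real (r n) * (real j / real Q))"
  have "norm ?z \<le> \<bar>Re ?z\<bar> + \<bar>Im ?z\<bar>"
    by (rule cmod_le)
  also have "\<dots> \<le> \<epsilon> * real N + \<epsilon> * real N"
    using grid[OF \<open>j < Q\<close>] by (intro add_mono) simp_all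
  finally have z: "norm ?z \<le> 2 * \<epsilon> * real N" by simp
  have "norm ((\<Sum>n<N. of_real (d n) * e (real (r n) * t)) - ?z) \<le>
      (\<Sum>n<N. norm (of_real (d n) * e (real (r n) * t) - of_real (d n) * e (real (r n) * (real j / real Q))))"
    by (simp only: sum_subtractf[symmetric]) (rule norm_sum)
  also have "\<dots> \<le> (\<Sum>n<N. 2 * pi / real N)"
  proof (rule sum_mono)
    fix n assume "n \<in> {..<N}"
    then have "r n \<le> r N"
      using r(1) by (auto intro: monoD)
    have "norm (of_real (d n) * e (real (r n) * t) - of_real (d n) * e (real (r n) * (real j / real Q)))
        = \<bar>d n\<bar> * norm (e (real (r n) * t) - e (real (r n) * (real j / real Q)))"
      by (metis norm_mult norm_of_real right_diff_distrib)
    also have "\<dots> \<le> 1 * (2 * pi * \<bar>real (r n) * t - real (r n) * (real j / real Q)\<bar>)"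
      using d by (intro mult_mono e_lipschitz) auto
    also have "\<dots> = 2 * pi * (real (r n) * \<bar>t - real j / real Q\<bar>)"
    proof -
      have "real (r n) * t - real (r n) * (real j / real Q) = real (r n) * (t - real j / real Q)"
        by (simp only: right_diff_distrib)
      then show ?thesis
        by (simp only: abs_mult abs_of_nat)
    qed
    also have "\<dots> \<le> 2 * pi * (real (r N) * (1 / real Q))"
      using near \<open>r n \<le> r N\<close> by (intro mult_left_mono mult_mono) auto
    also have "\<dots> = 2 * pi / real N"
      using r by (simp add: Q)
    finally show "norm (of_real (d n) * e (real (r n) * t) -
        of_real (d n) * e (real (r n) * (real j / real Q))) \<le> 2 * pi / real N" .
  qed
  also have "\<dots> = 2 * pi"
    using \<open>0 < N\<close> by simp
  finally have diff: "norm ((\<Sum>n<N. of_real (d n) * e (real (r n) * t)) - ?z) \<le> 2 * pi" .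
  have "norm (\<Sum>n<N. of_real (d n) * e (real (r n) * t)) \<le> 2 * pi + 2 * \<epsilon> * real N"
    using norm_triangle_ineq[of "(\<Sum>n<N. of_real (d n) * e (real (r n) * t)) - ?z" ?z] z diff by simp
  then have "norm (\<Sum>n<N. of_real (d n) * e (real (r n) * t)) / real N \<le> (2 * pi + 2 * \<epsilon> * real N) / real N"
    by (rule divide_right_mono) simp
  also have "\<dots> = 2 * \<epsilon> + 2 * pi / real N"
    using \<open>0 < N\<close> by (simp add: field_simps)
  finally show ?thesis
    by (simp add: avg_def e_t)
qed

text \<open>The number \<open>N * r N\<close> of grid frequencies is subexponential in \<open>N\<close>, so half of the exponent
  absorbs \<open>r N\<close> and the other half the factor \<open>N\<close>.\<close>

lemma summable_grid_bound:
  fixes r :: "nat \<Rightarrow> nat"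
  assumes growth: "\<And>\<delta>. 0 < \<delta> \<Longrightarrow> eventually (\<lambda>N. ln (real (r N)) \<le> \<delta> * real N) sequentially"
    and r: "\<And>n. 0 < r n" and "0 < \<kappa>"
  shows "summable (\<lambda>N. real (N * r N) * (4 * exp (- (\<kappa> * real N))))"
proof (rule summable_comparison_test_ev)
  show "summable (\<lambda>N. 1 / real N ^ 2)"
    using inverse_power_summable[of 2, where 'a = real] by (simp add: inverse_eq_divide)
  have "eventually (\<lambda>N. real N * (4 * exp (- (\<kappa> / 2 * real N))) \<le> 1 / real N ^ 2) sequentially"
    using \<open>0 < \<kappa>\<close> by real_asymp
  moreover have "eventually (\<lambda>N. ln (real (r N)) \<le> \<kappa> / 2 * real N) sequentially"
    using \<open>0 < \<kappa>\<close> by (intro growth) simp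
  ultimately show "eventually (\<lambda>N. norm (real (N * r N) * (4 * exp (- (\<kappa> * real N)))) \<le> 1 / real N ^ 2)
      sequentially"
  proof eventually_elim
    case (elim N)
    have "real (r N) = exp (ln (real (r N)))"
      using r[of N] by simp
    also have "\<dots> \<le> exp (\<kappa> / 2 * real N)"
      using elim by simp
    finally have "real N * (real (r N) * (4 * exp (- (\<kappa> * real N)))) \<le>
        real N * (exp (\<kappa> / 2 * real N) * (4 * exp (- (\<kappa> * real N))))"
      by (intro mult_left_mono mult_right_mono) auto
    then have "real (N * r N) * (4 * exp (- (\<kappa> * real N))) \<le>
        real N * (exp (\<kappa> / 2 * real N) * (4 * exp (- (\<kappa> * real N))))"
      by (simp add: mult.assoc)
    also have "exp (\<kappa> / 2 * real N) * (4 * exp (- (\<kappa> * real N))) = 4 * exp (- (\<kappa> / 2 * real N))"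
      by (simp add: mult.left_commute flip: exp_add)
    finally show ?case using elim by simp
  qed
qed

text \<open>Every index \<open>n\<close> is kept independently with probability \<open>p n\<close>. Hoeffding's inequality bounds
  the probability of a deviation at one frequency by a negative exponential in \<open>N\<close>, which beats
  the number of frequencies to be controlled, because \<open>r\<close> grows subexponentially.\<close>

lemma ex_selection:
  fixes r :: "nat \<Rightarrow> nat" and p :: "nat \<Rightarrow> real"
  assumes r: "mono r" "\<And>n. 0 < r n"
    and growth: "\<And>\<delta>. 0 < \<delta> \<Longrightarrow> eventually (\<lambda>N. ln (real (r N)) \<le> \<delta> * real N) sequentially"
    and p: "\<And>n. 0 \<le> p n" "\<And>n. p n \<le> 1"
  obtains \<omega> :: "nat \<Rightarrow> bool" where
    "\<And>\<beta>. avg (\<lambda>n. of_real (of_bool (\<omega> n) - p n) * e (real (r n) * \<beta>)) \<longlonglongrightarrow> 0"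
proof -
  let ?M = "selection_space p"
  interpret prob_space ?M by (rule prob_space_selection_space)
  define Q where "Q N = N * r N" for N
  define D where "D \<epsilon> c N = {\<omega> \<in> space ?M. \<epsilon> * real N \<le> \<bar>\<Sum>n<N. (of_bool (\<omega> n) - p n) * c n\<bar>}"
    for \<epsilon> :: real and c N
  define A where "A \<epsilon> N = (\<Union>j\<in>{..<Q N}. D \<epsilon> (\<lambda>n. Re (e (real (r n) * (real j / real (Q N))))) N \<union>
      D \<epsilon> (\<lambda>n. Im (e (real (r n) * (real j / real (Q N))))) N)" for \<epsilon> N
  have D_meas [measurable]: "D \<epsilon> c N \<in> sets ?M" for \<epsilon> c N
    unfolding D_def by measurable
  have A_meas [measurable]: "A \<epsilon> N \<in> sets ?M" for \<epsilon> N
    unfolding A_def by measurable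
  have A_prob: "prob (A \<epsilon> N) \<le> real (N * r N) * (4 * exp (- (\<epsilon>\<^sup>2 / 2 * real N)))" if "0 < \<epsilon>" for \<epsilon> N
  proof (cases "N = 0")
    case True
    then show ?thesis by (simp add: A_def Q_def)
  next
    case False
    have one: "prob (D \<epsilon> c N) \<le> 2 * exp (- (\<epsilon>\<^sup>2 / 2 * real N))" if "\<And>n. \<bar>c n\<bar> \<le> 1" for c
      using selection_deviation[OF p that \<open>0 < \<epsilon>\<close>, of N] False by (simp add: D_def)
    have "prob (A \<epsilon> N) \<le> (\<Sum>j<Q N. prob (D \<epsilon> (\<lambda>n. Re (e (real (r n) * (real j / real (Q N))))) N \<union>
      D \<epsilon> (\<lambda>n. Im (e (real (r n) * (real j / real (Q N))))) N))"
      unfolding A_def by (intro measure_UNION_le) auto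
    also have "\<dots> \<le> (\<Sum>j<Q N. 4 * exp (- (\<epsilon>\<^sup>2 / 2 * real N)))"
    proof (rule sum_mono)
      fix j
      let ?x = "\<lambda>n. e (real (r n) * (real j / real (Q N)))"
      have "prob (D \<epsilon> (\<lambda>n. Re (?x n)) N \<union> D \<epsilon> (\<lambda>n. Im (?x n)) N) \<le>
          prob (D \<epsilon> (\<lambda>n. Re (?x n)) N) + prob (D \<epsilon> (\<lambda>n. Im (?x n)) N)"
        by (intro measure_Un_le) auto
      also have "\<dots> \<le> 2 * exp (- (\<epsilon>\<^sup>2 / 2 * real N)) + 2 * exp (- (\<epsilon>\<^sup>2 / 2 * real N))"
        by (intro add_mono one order_trans[OF abs_Re_le_cmod] order_trans[OF abs_Im_le_cmod]) simp_all
      finally show "prob (D \<epsilon> (\<lambda>n. Re (?x n)) N \<union> D \<epsilon> (\<lambda>n. Im (?x n)) N) \<le>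
          4 * exp (- (\<epsilon>\<^sup>2 / 2 * real N))" by simp
    qed
    finally show ?thesis by (simp add: Q_def)
  qed
  have ae: "AE \<omega> in ?M. eventually (\<lambda>N. \<omega> \<in> space ?M - A \<epsilon> N) sequentially" if "0 < \<epsilon>" for \<epsilon>
  proof (rule borel_cantelli_AE1)
    have "summable (\<lambda>N. real (N * r N) * (4 * exp (- (\<epsilon>\<^sup>2 / 2 * real N))))"
      using that r growth by (intro summable_grid_bound) auto
    then show "summable (\<lambda>N. prob (A \<epsilon> N))"
      by (rule summable_comparison_test'[where N = 0]) (use A_prob[OF that] in auto)
  qed (auto simp: emeasure_eq_measure)
  have "AE \<omega> in ?M. \<forall>k. eventually (\<lambda>N. \<omega> \<in> space ?M - A (1 / real (Suc k)) N) sequentially"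
    unfolding AE_all_countable by (intro allI ae) simp
  then obtain \<omega> where \<omega>: "\<And>k. eventually (\<lambda>N. \<omega> \<in> space ?M - A (1 / real (Suc k)) N) sequentially"
    using eventually_happens'[OF ae_filter_bot] by blast
  have "avg (\<lambda>n. of_real (of_bool (\<omega> n) - p n) * e (real (r n) * \<beta>)) \<longlonglongrightarrow> 0" for \<beta>
  proof (rule tendstoI)
    fix \<eta> :: real assume "0 < \<eta>"
    then obtain k where k: "1 / real (Suc k) < \<eta> / 3"
      using nat_approx_posE[of "\<eta> / 3"] by auto
    define \<epsilon> where "\<epsilon> = 1 / real (Suc k)"
    have "eventually (\<lambda>N. 2 * pi / real N < \<eta> / 3) sequentially"
      using \<open>0 < \<eta>\<close> by real_asymp
    with \<omega>[of k] eventually_gt_at_top[of 0]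
    show "eventually (\<lambda>N. dist (avg (\<lambda>n. of_real (of_bool (\<omega> n) - p n) * e (real (r n) * \<beta>)) N) 0 < \<eta>)
        sequentially"
    proof eventually_elim
      case (elim N)
      have "norm (avg (\<lambda>n. of_real (of_bool (\<omega> n) - p n) * e (real (r n) * \<beta>)) N) \<le>
          2 * \<epsilon> + 2 * pi / real N"
      proof (rule exp_sum_grid[where Q = "Q N"])
        show "\<bar>of_bool (\<omega> n) - p n\<bar> \<le> 1" for n
          using p[of n] by (auto simp: abs_le_iff)
      qed (use elim r in \<open>auto simp: Q_def A_def D_def \<epsilon>_def not_le intro: less_imp_le\<close>)
      with elim k show ?case by (simp add: \<epsilon>_def)
    qed
  qed
  then show thesis by (rule that)
qed

section \<open>Counting functions and relative means\<close>

lemma enumerate_le_iff_less_count: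
  assumes "infinite S" "S \<subseteq> {1..}"
  shows "enumerate S n \<le> N \<longleftrightarrow> n < count_upto S N"
proof -
  have mono: "enumerate S m \<le> enumerate S n" if "m \<le> n" for m n
    using that assms(1) by simp
  define I where "I = {n. enumerate S n \<le> N}"
  have "I \<subseteq> {..N}"
    using le_enumerate[OF assms(1)] order_trans by (auto simp: I_def)
  then have "finite I" by (rule finite_subset) simp
  have "S \<inter> {1..N} = enumerate S ` I"
  proof (intro equalityI subsetI)
    fix s assume "s \<in> S \<inter> {1..N}"
    then show "s \<in> enumerate S ` I"
      using enumerate_Ex[OF assms(1), of s] by (auto simp: I_def)
  next
    fix s assume "s \<in> enumerate S ` I"
    then show "s \<in> S \<inter> {1..N}"
      using enumerate_in_set[OF assms(1)] assms(2) by (force simp: I_def)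
  qed
  then have count: "count_upto S N = card I"
    unfolding count_upto_def using inj_enumerate[OF assms(1)]
    by (simp add: card_image inj_on_subset)
  have down: "m \<in> I" if "n \<in> I" "m \<le> n" for m n
    using that mono[of m n] by (auto simp: I_def)
  have "I = {..<card I}"
  proof -
    have "n < card I" if "n \<in> I" for n
    proof -
      have "{..n} \<subseteq> I" using down that by auto
      then have "card {..n} \<le> card I"
        using \<open>finite I\<close> by (rule card_mono[rotated])
      then show ?thesis by simp
    qed
    then have "I \<subseteq> {..<card I}" by auto
    then show ?thesis
      using card_subset_eq[of "{..<card I}" I] by simp
  qed
  then show ?thesis
    unfolding count by (auto simp: I_def)
qed

lemma count_upto_enumerate:
  assumes "infinite S" "S \<subseteq> {1..}"
  shows "count_upto S (enumerate S n) = Suc n"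
proof -
  have "m < count_upto S (enumerate S n) \<longleftrightarrow> m < Suc n" for m
    using enumerate_le_iff_less_count[OF assms, of m "enumerate S n"] assms(1) by auto
  then show ?thesis
    by (meson less_irrefl not_less_iff_gr_or_eq)
qed

lemma filterlim_count_upto:
  assumes "infinite S" "S \<subseteq> {1..}"
  shows "filterlim (count_upto S) at_top sequentially"
  unfolding filterlim_at_top
proof
  fix Z
  have "Z \<le> count_upto S N" if "enumerate S Z \<le> N" for N
    using enumerate_le_iff_less_count[OF assms, of Z N] that by simp
  then show "eventually (\<lambda>N. Z \<le> count_upto S N) sequentially"
    unfolding eventually_sequentially by blast
qed

lemma sum_count_upto:
  assumes "infinite S" "S \<subseteq> {1..}"
  shows "(\<Sum>n<count_upto S N. f (enumerate S n)) = (\<Sum>s\<in>S \<inter> {1..N}. f s)"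
proof (rule sum.reindex_cong[symmetric, where l = "enumerate S"])
  show "inj_on (enumerate S) {..<count_upto S N}"
    using inj_enumerate[OF assms(1)] by (rule inj_on_subset) simp
  show "S \<inter> {1..N} = enumerate S ` {..<count_upto S N}"
  proof (intro equalityI subsetI)
    fix s assume "s \<in> S \<inter> {1..N}"
    then show "s \<in> enumerate S ` {..<count_upto S N}"
      using enumerate_Ex[OF assms(1), of s] enumerate_le_iff_less_count[OF assms] by force
  next
    fix s assume "s \<in> enumerate S ` {..<count_upto S N}"
    then show "s \<in> S \<inter> {1..N}"
      using enumerate_in_set[OF assms(1)] assms(2) enumerate_le_iff_less_count[OF assms] by force
  qed
qed simp

text \<open>At the \<open>n\<close>-th element of \<open>R\<close> the counting function is \<open>n + 1\<close>, so sublacunarity says that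
  the elements grow subexponentially in their index.\<close>

lemma sublacunary_growth:
  assumes "infinite R" "R \<subseteq> {1..}" "sublacunary R" "0 < \<delta>"
  shows "eventually (\<lambda>n. ln (real (enumerate R n)) \<le> \<delta> * real n) sequentially"
proof -
  have "filterlim (enumerate R) at_top sequentially"
    using assms(1) by (intro filterlim_subseq) (simp add: strict_mono_def)
  then have "filterlim (\<lambda>n. real (count_upto R (enumerate R n)) / ln (real (enumerate R n))) at_top sequentially"
    using assms(3) unfolding sublacunary_def by (rule filterlim_compose[rotated])
  then have "eventually (\<lambda>n. 2 / \<delta> \<le> real (Suc n) / ln (real (enumerate R n))) sequentially"
    unfolding count_upto_enumerate[OF assms(1,2)] by (simp add: filterlim_at_top)
  then show ?thesis
    using eventually_ge_at_top[of 1]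
  proof eventually_elim
    case (elim n)
    have "enumerate R n \<ge> 1"
      using enumerate_in_set[OF assms(1)] assms(2) by auto
    then consider "ln (real (enumerate R n)) = 0" | "ln (real (enumerate R n)) > 0"
      by (metis ln_ge_zero less_le of_nat_1 of_nat_mono)
    then show ?case
    proof cases
      case 1
      then show ?thesis using assms(4) by simp
    next
      case 2
      then have "2 * ln (real (enumerate R n)) \<le> \<delta> * real (Suc n)"
        using elim(1) assms(4) by (simp add: field_simps)
      also have "\<dots> \<le> \<delta> * (2 * real n)"
        using elim(2) assms(4) by (intro mult_left_mono) auto
      finally show ?thesis by simp
    qed
  qed
qed

text \<open>An average along a subset of positive relative mean is a quotient of two averages along the
  whole set.\<close>

lemma subset_averages:
  fixes R S :: "nat set"
  assumes R: "infinite R" "R \<subseteq> {1..}" and S: "S \<subseteq> R"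
    and m: "avg (\<lambda>n. of_bool (enumerate R n \<in> S)) \<longlonglongrightarrow> m" "0 < m"
  shows "infinite S" and "has_relative_mean R S m"
    and "avg (\<lambda>n. of_bool (enumerate R n \<in> S) *\<^sub>R f (enumerate R n)) \<longlonglongrightarrow> l \<Longrightarrow>
      avg (\<lambda>n. f (enumerate S n)) \<longlonglongrightarrow> (1 / m) *\<^sub>R (l :: 'a :: real_normed_vector)"
proof -
  show inf: "infinite S"
  proof
    assume "finite S"
    define K :: real where "K = real (card (enumerate R -` S))"
    have "finite (enumerate R -` S)"
      using \<open>finite S\<close> inj_enumerate[OF R(1)] by (rule finite_vimageI)
    then have "(\<Sum>n<N. of_bool (enumerate R n \<in> S)) \<le> K" for N
      unfolding K_def by (auto simp: sum.If_cases of_bool_def intro!: card_mono)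
    then have "eventually (\<lambda>N. avg (\<lambda>n. of_bool (enumerate R n \<in> S)) N \<le> m / 2) sequentially"
      using m(2) by (intro avg_bigo_bounded[where c = 0 and K = K]) auto
    with m(1) have "m \<le> m / 2"
      by (rule tendsto_upperbound) simp
    with m(2) show False by simp
  qed
  have S1: "S \<subseteq> {1..}" using S R by blast
  have sub: "(\<Sum>n<count_upto S N. g (enumerate S n)) =
      (\<Sum>n<count_upto R N. of_bool (enumerate R n \<in> S) *\<^sub>R g (enumerate R n))"
    for g :: "nat \<Rightarrow> 'b :: real_normed_vector" and N
  proof -
    have "(\<Sum>n<count_upto S N. g (enumerate S n)) = (\<Sum>s\<in>S \<inter> {1..N}. g s)"
      by (rule sum_count_upto[OF inf S1])
    also have "\<dots> = (\<Sum>s\<in>R \<inter> {1..N}. of_bool (s \<in> S) *\<^sub>R g s)"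
      using S by (intro sum.mono_neutral_cong_left) auto
    also have "\<dots> = (\<Sum>n<count_upto R N. of_bool (enumerate R n \<in> S) *\<^sub>R g (enumerate R n))"
      by (rule sum_count_upto[OF R, symmetric])
    finally show ?thesis .
  qed
  have cR: "filterlim (count_upto R) at_top sequentially"
    by (rule filterlim_count_upto[OF R])
  have ratio: "real (count_upto S N) / real (count_upto R N) =
      avg (\<lambda>n. of_bool (enumerate R n \<in> S)) (count_upto R N)" for N
    using sub[of "\<lambda>_. 1 :: real" N] by (simp add: avg_def)
  then show rel: "has_relative_mean R S m"
    unfolding has_relative_mean_def using filterlim_compose[OF m(1) cR] by simp
  show "avg (\<lambda>n. f (enumerate S n)) \<longlonglongrightarrow> (1 / m) *\<^sub>R l"
    if l: "avg (\<lambda>n. of_bool (enumerate R n \<in> S) *\<^sub>R f (enumerate R n)) \<longlonglongrightarrow> l"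
  proof -
    define G where "G = (\<lambda>N. (1 / (real (count_upto S N) / real (count_upto R N))) *\<^sub>R
        avg (\<lambda>n. of_bool (enumerate R n \<in> S) *\<^sub>R f (enumerate R n)) (count_upto R N))"
    have G: "G \<longlonglongrightarrow> (1 / m) *\<^sub>R l"
      unfolding G_def using rel[unfolded has_relative_mean_def] m(2)
      by (intro tendsto_intros filterlim_compose[OF l cR]) auto
    have "strict_mono (enumerate S)"
      using inf by (simp add: strict_mono_def)
    then have "(\<lambda>n. G (enumerate S n)) \<longlonglongrightarrow> (1 / m) *\<^sub>R l"
      using LIMSEQ_subseq_LIMSEQ[OF G] by (simp add: o_def)
    moreover have "G (enumerate S n) = avg (\<lambda>n. f (enumerate S n)) (Suc n)" for n
    proof -
      let ?N = "enumerate S n"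
      have cS: "count_upto S ?N = Suc n"
        by (rule count_upto_enumerate[OF inf S1])
      moreover have "count_upto S ?N \<le> count_upto R ?N"
        unfolding count_upto_def using S by (intro card_mono) auto
      ultimately have "0 < count_upto R ?N" by simp
      then have "G ?N = (1 / real (count_upto S ?N)) *\<^sub>R
          (\<Sum>n<count_upto R ?N. of_bool (enumerate R n \<in> S) *\<^sub>R f (enumerate R n))"
        by (simp add: G_def avg_def)
      also have "\<dots> = avg (\<lambda>n. f (enumerate S n)) (Suc n)"
        by (simp only: sub[symmetric] cS avg_def)
      finally show ?thesis .
    qed
    ultimately have "(\<lambda>n. avg (\<lambda>n. f (enumerate S n)) (Suc n)) \<longlonglongrightarrow> (1 / m) *\<^sub>R l"
      by simp
    then show ?thesis
      by (rule LIMSEQ_imp_Suc)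
  qed
qed

section \<open>Good subsets of positive upper relative mean\<close>

text \<open>The hypothesis is tested on the set where the bound fails.\<close>

lemma AE_le_if_nn_integral_le:
  assumes [measurable]: "f \<in> borel_measurable M" and "finite_measure M"
    and le: "\<And>A. A \<in> sets M \<Longrightarrow> (\<integral>\<^sup>+x. f x * indicator A x \<partial>M) \<le> ennreal K * emeasure M A"
  shows "AE x in M. f x \<le> ennreal K"
proof -
  interpret finite_measure M by fact
  define A where "A = {x \<in> space M. ennreal K < f x}"
  have [measurable]: "A \<in> sets M"
    unfolding A_def by measurable
  have fin: "ennreal K * emeasure M A < \<infinity>"
    by (auto simp: ennreal_mult_eq_top_iff emeasure_eq_measure less_top[symmetric])
  have "(\<integral>\<^sup>+x. (f x - ennreal K) * indicator A x \<partial>M) + ennreal K * emeasure M A =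
      (\<integral>\<^sup>+x. (f x - ennreal K) * indicator A x + ennreal K * indicator A x \<partial>M)"
    by (subst nn_integral_add) (auto simp: nn_integral_cmult_indicator)
  also have "\<dots> = (\<integral>\<^sup>+x. f x * indicator A x \<partial>M)"
    by (intro nn_integral_cong) (auto simp: A_def indicator_def diff_add_cancel_ennreal less_imp_le)
  also have "\<dots> \<le> 0 + ennreal K * emeasure M A"
    using le[of A] by simp
  finally have "(\<integral>\<^sup>+x. (f x - ennreal K) * indicator A x \<partial>M) = 0"
    using fin by (simp add: add.commute[of _ "ennreal K * emeasure M A"])
      (metis ennreal_add_left_cancel_le add.right_neutral infinity_ennreal_def le_zero_eq less_top)
  then have "AE x in M. (f x - ennreal K) * indicator A x = 0"
    by (subst (asm) nn_integral_0_iff_AE) auto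
  then show ?thesis
    using AE_space
  proof eventually_elim
    case (elim x)
    then show ?case
      by (cases "ennreal K < f x") (auto simp: A_def diff_eq_0_iff_ennreal)
  qed
qed

text \<open>Along the cut-offs at which \<open>S\<close> has relative frequency more than \<open>t\<close>, an average over \<open>S\<close> of
  a nonnegative function is at most \<open>1 / t\<close> times the average over \<open>R\<close>.\<close>

lemma limit_measure_subset_le:
  assumes R: "good R" and S: "good S" "S \<subseteq> R"
    and c: "upper_relative_mean R S = ereal c" "0 < c" and A: "A \<in> sets borel"
  shows "measure (limit_measure S \<beta>) A \<le> 1 / c * measure (limit_measure R \<beta>) A"
proof (rule measure_le_if_integral_le[OF _ sets_limit_measure[OF S(1)] _ sets_limit_measure[OF R] _ _ A])
  show "finite_measure (limit_measure S \<beta>)" "finite_measure (limit_measure R \<beta>)"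
    using prob_space_limit_measure S(1) R prob_space.finite_measure by blast+
  show "0 \<le> 1 / c" using c by simp
  fix f :: "circle \<Rightarrow> real"
  assume f: "continuous_on UNIV f" "\<And>x. 0 \<le> f x"
  have R': "infinite R" "R \<subseteq> {1..}" and S': "infinite S" "S \<subseteq> {1..}"
    using R S by (simp_all add: good_def)
  let ?I = "integral\<^sup>L (limit_measure S \<beta>) f" and ?J = "integral\<^sup>L (limit_measure R \<beta>) f"
  define q where "q N = real (count_upto S N) / real (count_upto R N)" for N
  define a where "a N = avg (\<lambda>n. f (orbit S \<beta> n)) (count_upto S N)" for N
  define b where "b N = avg (\<lambda>n. f (orbit R \<beta> n)) (count_upto R N)" for N
  have a: "a \<longlonglongrightarrow> ?I"
    unfolding a_def
    by (rule filterlim_compose[OF limit_measure_tendsto[OF S(1) f(1)] filterlim_count_upto[OF S']])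
  have b: "b \<longlonglongrightarrow> ?J"
    unfolding b_def
    by (rule filterlim_compose[OF limit_measure_tendsto[OF R f(1)] filterlim_count_upto[OF R']])
  have a0: "0 \<le> a N" for N
    unfolding a_def avg_def using f(2) by (simp add: sum_nonneg)
  have qab: "q N * a N \<le> b N" for N
  proof (cases "count_upto S N = 0")
    case True
    then show ?thesis
      unfolding q_def b_def avg_def using f(2) by (simp add: sum_nonneg)
  next
    case False
    have "q N * a N = (\<Sum>s\<in>S \<inter> {1..N}. f (to_circle (real s * \<beta>))) / real (count_upto R N)"
      using False sum_count_upto[OF S', of "\<lambda>s. f (to_circle (real s * \<beta>))" N]
      by (simp add: q_def a_def avg_def)
    also have "\<dots> \<le> (\<Sum>s\<in>R \<inter> {1..N}. f (to_circle (real s * \<beta>))) / real (count_upto R N)"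
      using S(2) f(2) by (intro divide_right_mono sum_mono2) auto
    also have "\<dots> = b N"
      using sum_count_upto[OF R', of "\<lambda>s. f (to_circle (real s * \<beta>))" N]
      by (simp add: b_def avg_def)
    finally show ?thesis .
  qed
  have "t * ?I \<le> ?J" if "0 < t" "t < c" for t
  proof (rule ccontr)
    assume "\<not> t * ?I \<le> ?J"
    then have "eventually (\<lambda>N. b N - t * a N < 0) sequentially"
      by (intro order_tendstoD(2)[OF tendsto_diff[OF b tendsto_mult_left[OF a]]]) simp
    then have "eventually (\<lambda>N. ereal (q N) \<le> ereal t) sequentially"
    proof eventually_elim
      case (elim N)
      have "\<not> t < q N"
        using elim qab[of N] mult_right_mono[OF less_imp_le a0, of t "q N" N] by fastforce
      then show ?case by simp
    qed
    then have "limsup (\<lambda>N. ereal (q N)) \<le> ereal t"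
      by (rule Limsup_bounded)
    then show False
      using c that by (simp add: upper_relative_mean_def q_def)
  qed
  then have "z * (c * ?I) \<le> ?J" if "0 < z" "z < 1" for z
    using that c by (simp flip: mult.assoc)
  then have "c * ?I \<le> ?J"
    by (rule field_le_mult_one_interval)
  then show "?I \<le> 1 / c * ?J"
    using c by (simp add: field_simps)
qed

lemma good_subset_density:
  fixes \<beta> :: real
  assumes R: "good R" and S: "good S" "S \<subseteq> R" and pos: "0 < upper_relative_mean R S"
  defines "\<mu> \<equiv> limit_measure R \<beta>" and "\<nu> \<equiv> limit_measure S \<beta>"
  shows "absolutely_continuous \<mu> \<nu>"
    and "Linf_norm \<mu> (\<lambda>x. enn2ereal (RN_deriv \<mu> \<nu> x)) \<le> 1 / upper_relative_mean R S"
    and "Linf_norm \<mu> (\<lambda>x. enn2ereal (RN_deriv \<mu> \<nu> x)) < \<infinity>"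
proof -
  interpret \<mu>: prob_space \<mu> unfolding \<mu>_def by (rule prob_space_limit_measure[OF R])
  interpret \<nu>: prob_space \<nu> unfolding \<nu>_def by (rule prob_space_limit_measure[OF S(1)])
  have sets: "sets \<mu> = sets borel" "sets \<nu> = sets borel"
    unfolding \<mu>_def \<nu>_def using R S sets_limit_measure by auto
  have "real (count_upto S N) / real (count_upto R N) \<le> 1" for N
  proof -
    have "count_upto S N \<le> count_upto R N"
      unfolding count_upto_def using S(2) by (intro card_mono) auto
    then show ?thesis by (cases "count_upto R N = 0") (auto simp: divide_le_eq)
  qed
  then have "upper_relative_mean R S \<le> 1"
    unfolding upper_relative_mean_def by (intro Limsup_bounded always_eventually) simp
  then obtain c where c: "upper_relative_mean R S = ereal c" "0 < c"
    using pos by (cases "upper_relative_mean R S") auto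
  have le: "emeasure \<nu> A \<le> ennreal (1 / c) * emeasure \<mu> A" if "A \<in> sets \<mu>" for A
    using limit_measure_subset_le[OF R S c, of A \<beta>] that c sets
    by (simp add: \<mu>.emeasure_eq_measure \<nu>.emeasure_eq_measure ennreal_mult[symmetric] \<mu>_def[symmetric] \<nu>_def[symmetric])
  show ac: "absolutely_continuous \<mu> \<nu>"
    unfolding absolutely_continuous_def
  proof
    fix A assume "A \<in> null_sets \<mu>"
    then show "A \<in> null_sets \<nu>"
      using le[of A] sets by (auto simp: null_sets_def)
  qed
  have "AE x in \<mu>. RN_deriv \<mu> \<nu> x \<le> ennreal (1 / c)"
  proof (rule AE_le_if_nn_integral_le)
    fix A assume A: "A \<in> sets \<mu>"
    have "(\<integral>\<^sup>+x. RN_deriv \<mu> \<nu> x * indicator A x \<partial>\<mu>) = emeasure (density \<mu> (RN_deriv \<mu> \<nu>)) A"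
      using A by (simp add: emeasure_density)
    also have "density \<mu> (RN_deriv \<mu> \<nu>) = \<nu>"
      using ac sets by (intro \<mu>.density_RN_deriv) auto
    finally show "(\<integral>\<^sup>+x. RN_deriv \<mu> \<nu> x * indicator A x \<partial>\<mu>) \<le> ennreal (1 / c) * emeasure \<mu> A"
      using le[OF A] by simp
  qed (auto intro: \<mu>.finite_measure_axioms)
  then have "AE x in \<mu>. \<bar>enn2ereal (RN_deriv \<mu> \<nu> x)\<bar> \<le> ereal (1 / c)"
  proof eventually_elim
    case (elim x)
    then have "enn2ereal (RN_deriv \<mu> \<nu> x) \<le> enn2ereal (ennreal (1 / c))"
      by (simp add: less_eq_ennreal.rep_eq)
    then show ?case
      using c by simp
  qed
  then have "Linf_norm \<mu> (\<lambda>x. enn2ereal (RN_deriv \<mu> \<nu> x)) \<le> ereal (1 / c)"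
    unfolding Linf_norm_def by (intro esssup_I) auto
  then show "Linf_norm \<mu> (\<lambda>x. enn2ereal (RN_deriv \<mu> \<nu> x)) \<le> 1 / upper_relative_mean R S"
    and "Linf_norm \<mu> (\<lambda>x. enn2ereal (RN_deriv \<mu> \<nu> x)) < \<infinity>"
    using c by (auto simp: one_ereal_def)
qed

section \<open>Realising a bounded density\<close>

lemma avg_weighted_approx:
  fixes u :: "nat \<Rightarrow> 'a :: banach" and p :: "nat \<Rightarrow> real"
  assumes u: "\<And>n. norm (u n) \<le> C"
    and close: "\<And>i. eventually (\<lambda>N. avg (\<lambda>n. \<bar>p n - w i n\<bar>) N \<le> d i) sequentially"
    and d: "d \<longlonglongrightarrow> 0"
    and lim: "\<And>i. avg (\<lambda>n. w i n *\<^sub>R u n) \<longlonglongrightarrow> l i"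
  obtains L where "avg (\<lambda>n. p n *\<^sub>R u n) \<longlonglongrightarrow> L" "l \<longlonglongrightarrow> L"
proof (rule avg_convergent_approx[OF lim, where d = "\<lambda>i. C * d i" and w = "\<lambda>n. p n *\<^sub>R u n"])
  have "0 \<le> C"
    using u[of 0] norm_ge_zero order_trans by blast
  show "(\<lambda>i. C * d i) \<longlonglongrightarrow> 0"
    using tendsto_mult_left[OF d, of C] by simp
  show "eventually (\<lambda>N. avg (\<lambda>n. norm (p n *\<^sub>R u n - w i n *\<^sub>R u n)) N \<le> C * d i) sequentially" for i
    using close[of i]
  proof eventually_elim
    case (elim N)
    have "norm (p n *\<^sub>R u n - w i n *\<^sub>R u n) \<le> C * \<bar>p n - w i n\<bar>" for n
    proof -
      have "norm (p n *\<^sub>R u n - w i n *\<^sub>R u n) = norm (u n) * \<bar>p n - w i n\<bar>"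
        by (simp flip: scaleR_diff_left)
      then show ?thesis
        using mult_right_mono[OF u[of n], of "\<bar>p n - w i n\<bar>"] by simp
    qed
    then have "avg (\<lambda>n. norm (p n *\<^sub>R u n - w i n *\<^sub>R u n)) N \<le> avg (\<lambda>n. C * \<bar>p n - w i n\<bar>) N"
      by (rule avg_mono)
    also have "\<dots> = C * avg (\<lambda>n. \<bar>p n - w i n\<bar>) N"
      by (rule avg_mult_left)
    also have "\<dots> \<le> C * d i"
      using elim \<open>0 \<le> C\<close> by (rule mult_left_mono)
    finally show ?case .
  qed
qed (use that in auto)

text \<open>The function \<open>\<rho>\<close> is only defined up to null sets, and the orbit of \<open>\<alpha>\<close> may well be null, so
  \<open>\<rho>\<close> cannot be evaluated along the orbit. Its continuous approximations can, and the resulting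
  sequences of weights are Cauchy in the Besicovitch seminorm.\<close>

lemma ex_weights:
  assumes R: "good R"
    and \<rho>: "integrable (limit_measure R \<alpha>) \<rho>" "AE x in limit_measure R \<alpha>. 0 \<le> \<rho> x"
      "AE x in limit_measure R \<alpha>. \<rho> x \<le> B" and B: "1 \<le> B"
  obtains p :: "nat \<Rightarrow> real" where "\<And>n. 0 \<le> p n" "\<And>n. p n \<le> 1"
    "\<And>\<beta>. convergent (avg (\<lambda>n. p n *\<^sub>R e (real (enumerate R n) * \<beta>)))"
    "\<And>f :: circle \<Rightarrow> real. continuous_on UNIV f \<Longrightarrow>
        avg (\<lambda>n. p n * f (orbit R \<alpha> n)) \<longlonglongrightarrow> (\<integral>x. f x * \<rho> x \<partial>limit_measure R \<alpha>) / B"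
proof -
  define \<mu> where "\<mu> = limit_measure R \<alpha>"
  interpret prob_space \<mu> unfolding \<mu>_def by (rule prob_space_limit_measure[OF R])
  have sets_\<mu>: "sets \<mu> = sets borel" unfolding \<mu>_def by (rule sets_limit_measure[OF R])
  note \<rho> = \<rho>[folded \<mu>_def]
  define d where "d i = 1 / real (Suc i)" for i
  have d0: "0 < d i" for i by (simp add: d_def)
  have "\<exists>g. continuous_on UNIV g \<and> (\<forall>x. 0 \<le> g x \<and> g x \<le> B) \<and> (\<integral>x. \<bar>\<rho> x - g x\<bar> \<partial>\<mu>) < d i / 2" for i
    using continuous_dense_L1_bounded[OF finite_measure_axioms sets_\<mu> \<rho>, of "d i / 2"] B d0[of i]
    by (metis half_gt_zero order_trans zero_le_one)
  then obtain g where g: "\<And>i. continuous_on UNIV (g i)" "\<And>i x. 0 \<le> g i x" "\<And>i x. g i x \<le> B"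
    "\<And>i. (\<integral>x. \<bar>\<rho> x - g i x\<bar> \<partial>\<mu>) < d i / 2"
    by metis
  have int: "integrable \<mu> f" if "continuous_on UNIV f" for f :: "circle \<Rightarrow> real"
    using integrable_continuous_circle[OF finite_measure_axioms sets_\<mu> that] .
  define w where "w i n = g i (orbit R \<alpha> n) / B" for i n
  have w01: "0 \<le> w i n" "w i n \<le> 1" for i n
    using g B by (auto simp: w_def)
  have cauchy: "eventually (\<lambda>N. avg (\<lambda>n. norm (w j n - w i n)) N \<le> d i) sequentially" if "i \<le> j" for i j
  proof -
    define h where "h x = \<bar>g j x / B - g i x / B\<bar>" for x
    have h: "continuous_on UNIV h"
      unfolding h_def using g B by (intro continuous_intros) auto
    have "integral\<^sup>L \<mu> h \<le> (\<integral>x. \<bar>\<rho> x - g j x\<bar> + \<bar>\<rho> x - g i x\<bar> \<partial>\<mu>)"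
    proof (rule integral_mono)
      fix x
      have "h x = \<bar>g j x - g i x\<bar> / B"
        using B by (simp add: h_def diff_divide_distrib[symmetric])
      also have "\<dots> \<le> \<bar>g j x - g i x\<bar>"
        using B by (simp add: divide_le_eq mult_left_le mult.commute)
          (metis abs_ge_zero mult_right_mono mult_1)
      finally show "h x \<le> \<bar>\<rho> x - g j x\<bar> + \<bar>\<rho> x - g i x\<bar>" by linarith
    qed (use \<rho>(1) int g(1) h in auto)
    also have "\<dots> = (\<integral>x. \<bar>\<rho> x - g j x\<bar> \<partial>\<mu>) + (\<integral>x. \<bar>\<rho> x - g i x\<bar> \<partial>\<mu>)"
      using \<rho>(1) int g(1) by (intro Bochner_Integration.integral_add) auto
    also have "\<dots> < d j / 2 + d i / 2"
      using g(4)[of i] g(4)[of j] by simp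
    also have "d j \<le> d i"
      using that by (simp add: d_def frac_le)
    finally have "integral\<^sup>L \<mu> h < d i" by simp
    moreover have "avg (\<lambda>n. h (orbit R \<alpha> n)) \<longlonglongrightarrow> integral\<^sup>L \<mu> h"
      unfolding \<mu>_def by (rule limit_measure_tendsto[OF R h])
    ultimately have "eventually (\<lambda>N. avg (\<lambda>n. h (orbit R \<alpha> n)) N < d i) sequentially"
      by (intro order_tendstoD(2))
    then show ?thesis
      by (rule eventually_mono) (simp add: h_def w_def)
  qed
  obtain J where J: "\<And>i. eventually (\<lambda>N. avg (\<lambda>n. norm (w (J n) n - w i n)) N \<le> 4 * d i) sequentially"
    using avg_seminorm_complete[of w d, OF cauchy d0] by blast
  define p where "p n = w (J n) n" for n
  have close: "\<And>i. eventually (\<lambda>N. avg (\<lambda>n. \<bar>p n - w i n\<bar>) N \<le> 4 * d i) sequentially"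
    using J by (simp add: p_def)
  have d4: "(\<lambda>i. 4 * d i) \<longlonglongrightarrow> 0"
    unfolding d_def by real_asymp
  show thesis
  proof (rule that[of p])
    show "0 \<le> p n" "p n \<le> 1" for n
      using w01 by (simp_all add: p_def)
  next
    fix \<beta>
    let ?u = "\<lambda>n. e (real (enumerate R n) * \<beta>)"
    have "convergent (avg (\<lambda>n. ?u n * of_real (g i (orbit R \<alpha> n) / B)))" for i
      using g(1) B by (intro good_avg_continuous_convergent[OF R] continuous_intros) auto
    then have "\<exists>l. avg (\<lambda>n. w i n *\<^sub>R ?u n) \<longlonglongrightarrow> l" for i
      by (simp add: w_def convergent_def scaleR_conv_of_real mult.commute)
    then obtain l where l: "\<And>i. avg (\<lambda>n. w i n *\<^sub>R ?u n) \<longlonglongrightarrow> l i"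
      by metis
    have u: "norm (?u n) \<le> 1" for n by simp
    obtain L where "avg (\<lambda>n. p n *\<^sub>R ?u n) \<longlonglongrightarrow> L"
      by (rule avg_weighted_approx[OF u close d4 l])
    then show "convergent (avg (\<lambda>n. p n *\<^sub>R ?u n))"
      by (auto simp: convergent_def)
  next
    fix f :: "circle \<Rightarrow> real" assume f: "continuous_on UNIV f"
    obtain C where C: "0 \<le> C" "\<And>x. \<bar>f x\<bar> \<le> C"
      using bounded_continuous_circle[OF f] by blast
    define l where "l i = (\<integral>x. g i x / B * f x \<partial>\<mu>)" for i
    have l: "avg (\<lambda>n. w i n *\<^sub>R f (orbit R \<alpha> n)) \<longlonglongrightarrow> l i" for i
      unfolding w_def l_def \<mu>_def real_scaleR_def using B
      by (intro limit_measure_tendsto[OF R] continuous_intros f g(1)) auto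
    have u: "norm (f (orbit R \<alpha> n)) \<le> C" for n
      using C by simp
    obtain L where L: "avg (\<lambda>n. p n *\<^sub>R f (orbit R \<alpha> n)) \<longlonglongrightarrow> L" "l \<longlonglongrightarrow> L"
      by (rule avg_weighted_approx[OF u close d4 l])
    have f\<rho>: "integrable \<mu> (\<lambda>x. f x * \<rho> x)"
    proof (rule Bochner_Integration.integrable_bound)
      show "integrable \<mu> (\<lambda>x. C * \<rho> x)"
        using \<rho>(1) by simp
      show "AE x in \<mu>. norm (f x * \<rho> x) \<le> norm (C * \<rho> x)"
        using C by (auto simp: abs_mult intro!: mult_right_mono)
    qed (use \<rho>(1) measurable_continuous_circle[OF f sets_\<mu>] in simp)
    have bound: "norm (l i - (\<integral>x. f x * \<rho> x \<partial>\<mu>) / B) \<le> C * (d i / 2)" for i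
    proof -
      have gf: "integrable \<mu> (\<lambda>x. g i x / B * f x)"
        using B by (intro int continuous_intros f g(1)) auto
      have "l i - (\<integral>x. f x * \<rho> x \<partial>\<mu>) / B = (\<integral>x. g i x / B * f x - f x * \<rho> x / B \<partial>\<mu>)"
        unfolding l_def using f\<rho> gf by simp
      also have "\<bar>\<dots>\<bar> \<le> (\<integral>x. \<bar>g i x / B * f x - f x * \<rho> x / B\<bar> \<partial>\<mu>)"
        by (rule integral_abs_bound)
      also have "\<dots> \<le> (\<integral>x. C * \<bar>\<rho> x - g i x\<bar> \<partial>\<mu>)"
      proof (rule integral_mono)
        fix x
        have "g i x / B * f x - f x * \<rho> x / B = f x / B * (g i x - \<rho> x)"
          using B by (simp add: field_simps)
        then have "\<bar>g i x / B * f x - f x * \<rho> x / B\<bar> = \<bar>f x\<bar> / B * \<bar>\<rho> x - g i x\<bar>"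
          using B by (simp add: abs_mult abs_minus_commute)
        also have "\<bar>f x\<bar> / B \<le> C"
          using frac_le[of C "\<bar>f x\<bar>" 1 B] B C by simp
        then have "\<bar>f x\<bar> / B * \<bar>\<rho> x - g i x\<bar> \<le> C * \<bar>\<rho> x - g i x\<bar>"
          by (rule mult_right_mono) simp
        finally show "\<bar>g i x / B * f x - f x * \<rho> x / B\<bar> \<le> C * \<bar>\<rho> x - g i x\<bar>" .
      qed (use f\<rho> gf \<rho>(1) int g(1) in auto)
      also have "\<dots> = C * (\<integral>x. \<bar>\<rho> x - g i x\<bar> \<partial>\<mu>)"
        by simp
      also have "\<dots> \<le> C * (d i / 2)"
        using C g(4)[of i] by (intro mult_left_mono) auto
      finally show ?thesis by simp
    qed
    have "(\<lambda>i. C * (d i / 2)) \<longlonglongrightarrow> 0"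
      unfolding d_def by real_asymp
    then have "(\<lambda>i. l i - (\<integral>x. f x * \<rho> x \<partial>\<mu>) / B) \<longlonglongrightarrow> 0"
      by (rule Lim_null_comparison[OF always_eventually[OF allI[OF bound]]])
    then have "l \<longlonglongrightarrow> (\<integral>x. f x * \<rho> x \<partial>\<mu>) / B"
      by (rule LIM_zero_cancel)
    then have "L = (\<integral>x. f x * \<rho> x \<partial>\<mu>) / B"
      by (rule LIMSEQ_unique[OF L(2)])
    then show "avg (\<lambda>n. p n * f (orbit R \<alpha> n)) \<longlonglongrightarrow> (\<integral>x. f x * \<rho> x \<partial>limit_measure R \<alpha>) / B"
      using L(1) by (simp add: \<mu>_def)
  qed
qed

text \<open>Dividing \<open>\<rho>\<close> by its bound makes the weights probabilities. Elements of \<open>R\<close> are selected with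
  these probabilities; averages over the selected set agree with weighted averages over \<open>R\<close> up to
  normalization by the relative mean \<open>1 / B\<close>, which is the mean of the weights because \<open>\<rho>\<close> has
  integral 1.\<close>

lemma ex_good_subset_density:
  fixes \<rho> :: "circle \<Rightarrow> real"
  assumes R: "good R" "sublacunary R"
    and \<rho>: "integrable (limit_measure R \<alpha>) \<rho>" "AE x in limit_measure R \<alpha>. 0 \<le> \<rho> x"
      "AE x in limit_measure R \<alpha>. \<rho> x \<le> B" "integral\<^sup>L (limit_measure R \<alpha>) \<rho> = 1" and B: "1 \<le> B"
  obtains S where "S \<subseteq> R" "good S"
    "limit_measure S \<alpha> = density (limit_measure R \<alpha>) (\<lambda>x. ennreal (\<rho> x))"
    "has_relative_mean R S (1 / B)"
proof -
  have R': "infinite R" "R \<subseteq> {1..}"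
    using R(1) by (simp_all add: good_def)
  obtain p :: "nat \<Rightarrow> real" where p: "\<And>n. 0 \<le> p n" "\<And>n. p n \<le> 1"
    and p_conv: "\<And>\<beta>. convergent (avg (\<lambda>n. p n *\<^sub>R e (real (enumerate R n) * \<beta>)))"
    and p_lim: "\<And>f :: circle \<Rightarrow> real. continuous_on UNIV f \<Longrightarrow>
        avg (\<lambda>n. p n * f (orbit R \<alpha> n)) \<longlonglongrightarrow> (\<integral>x. f x * \<rho> x \<partial>limit_measure R \<alpha>) / B"
    by (rule ex_weights[OF R(1) \<rho>(1,2,3) B]) (rule that)
  obtain \<omega> where \<omega>: "\<And>\<beta>. avg (\<lambda>n. of_real (of_bool (\<omega> n) - p n) * e (real (enumerate R n) * \<beta>)) \<longlonglongrightarrow> 0"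
  proof (rule ex_selection[of "enumerate R" p])
    show "mono (enumerate R)"
      using R'(1) by (simp add: mono_def)
    show "0 < enumerate R n" for n
      using enumerate_in_set[OF R'(1), of n] R'(2) by auto
    show "eventually (\<lambda>N. ln (real (enumerate R N)) \<le> \<delta> * real N) sequentially" if "0 < \<delta>" for \<delta>
      by (rule sublacunary_growth[OF R' R(2) that])
  qed (use p in auto)
  define S where "S = enumerate R ` {n. \<omega> n}"
  have in_S: "enumerate R n \<in> S \<longleftrightarrow> \<omega> n" for n
    using inj_enumerate[OF R'(1)] by (auto simp: S_def inj_def)
  have "S \<subseteq> R"
    using enumerate_in_set[OF R'(1)] by (auto simp: S_def)
  have real_lim: "avg (\<lambda>n. of_bool (\<omega> n) * f (orbit R \<alpha> n)) \<longlonglongrightarrow>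
      (\<integral>x. f x * \<rho> x \<partial>limit_measure R \<alpha>) / B"
    if f: "f = (\<lambda>x. Re (c * circle_emb x ^ k))" for f c k
  proof -
    have "(\<lambda>N. Re (c * avg (\<lambda>n. of_real (of_bool (\<omega> n) - p n) * e (real (enumerate R n) * (real k * \<alpha>))) N))
        \<longlonglongrightarrow> Re (c * 0)"
      by (intro tendsto_Re tendsto_mult_left \<omega>)
    moreover have "Re (c * avg (\<lambda>n. of_real (of_bool (\<omega> n) - p n) * e (real (enumerate R n) * (real k * \<alpha>))) N) =
        avg (\<lambda>n. (of_bool (\<omega> n) - p n) * f (orbit R \<alpha> n)) N" for N
    proof -
      have "(of_bool (\<omega> n) - p n) * f (orbit R \<alpha> n) =
          Re (c * (of_real (of_bool (\<omega> n) - p n) * e (real (enumerate R n) * (real k * \<alpha>))))" for n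
      proof -
        have "c * (of_real (of_bool (\<omega> n) - p n) * e (real (enumerate R n) * (real k * \<alpha>))) =
            of_real (of_bool (\<omega> n) - p n) * (c * e (real k * (real (enumerate R n) * \<alpha>)))"
          by (simp only: mult.left_commute)
        moreover have "Re (of_real t * z) = t * Re z" for t z
          by simp
        ultimately show ?thesis
          by (simp only: f circle_emb_to_circle e_power)
      qed
      then show ?thesis
        by (simp only: avg_bounded_linear[OF bounded_linear_Re] avg_mult_left)
    qed
    moreover have "avg (\<lambda>n. p n * f (orbit R \<alpha> n)) \<longlonglongrightarrow> (\<integral>x. f x * \<rho> x \<partial>limit_measure R \<alpha>) / B"
      unfolding f by (intro p_lim continuous_intros continuous_circle_emb)
    ultimately have "(\<lambda>N. avg (\<lambda>n. (of_bool (\<omega> n) - p n) * f (orbit R \<alpha> n)) N +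
        avg (\<lambda>n. p n * f (orbit R \<alpha> n)) N) \<longlonglongrightarrow> 0 + (\<integral>x. f x * \<rho> x \<partial>limit_measure R \<alpha>) / B"
      by (intro tendsto_add) simp_all
    then show ?thesis
      by (simp add: avg_add[symmetric] left_diff_distrib)
  qed
  have m: "avg (\<lambda>n. of_bool (enumerate R n \<in> S)) \<longlonglongrightarrow> 1 / B"
    using real_lim[of "\<lambda>_. 1" 1 0] \<rho>(4) by (simp add: in_S)
  have "0 < 1 / B" using B by simp
  note sub = subset_averages[OF R' \<open>S \<subseteq> R\<close> m \<open>0 < 1 / B\<close>]
  have "good S"
    unfolding good_iff_avg
  proof (intro conjI allI)
    show "S \<subseteq> {1..}" using \<open>S \<subseteq> R\<close> R'(2) by blast
    show "infinite S" by (rule sub(1))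
    fix \<beta>
    obtain L where L: "avg (\<lambda>n. p n *\<^sub>R e (real (enumerate R n) * \<beta>)) \<longlonglongrightarrow> L"
      using p_conv by (auto simp: convergent_def)
    have "(\<lambda>N. avg (\<lambda>n. of_real (of_bool (\<omega> n) - p n) * e (real (enumerate R n) * \<beta>)) N +
        avg (\<lambda>n. p n *\<^sub>R e (real (enumerate R n) * \<beta>)) N) \<longlonglongrightarrow> 0 + L"
      by (intro tendsto_add \<omega> L)
    moreover have "of_real (of_bool (\<omega> n) - p n) * e (real (enumerate R n) * \<beta>) + p n *\<^sub>R e (real (enumerate R n) * \<beta>) =
        of_bool (\<omega> n) *\<^sub>R e (real (enumerate R n) * \<beta>)" for n
      by (simp add: scaleR_conv_of_real left_diff_distrib)
    ultimately have "avg (\<lambda>n. of_bool (enumerate R n \<in> S) *\<^sub>R e (real (enumerate R n) * \<beta>)) \<longlonglongrightarrow> L"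
      by (simp add: avg_add[symmetric] in_S)
    then show "convergent (avg (\<lambda>n. e (real (enumerate S n) * \<beta>)))"
      using sub(3)[of "\<lambda>s. e (real s * \<beta>)" L] by (auto simp: convergent_def)
  qed
  interpret \<mu>: prob_space "limit_measure R \<alpha>" by (rule prob_space_limit_measure[OF R(1)])
  have sets_\<mu> [measurable_cong]: "sets (limit_measure R \<alpha>) = sets borel"
    by (rule sets_limit_measure[OF R(1)])
  have [measurable]: "\<rho> \<in> borel_measurable (limit_measure R \<alpha>)"
    using \<rho>(1) by simp
  have "limit_measure S \<alpha> = density (limit_measure R \<alpha>) (\<lambda>x. ennreal (\<rho> x))"
  proof (rule measure_eqI_trig)
    show "prob_space (density (limit_measure R \<alpha>) (\<lambda>x. ennreal (\<rho> x)))"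
    proof (rule prob_spaceI)
      have "(\<integral>\<^sup>+x. ennreal (\<rho> x) \<partial>limit_measure R \<alpha>) = 1"
        using \<rho> by (simp add: nn_integral_eq_integral)
      then show "emeasure (density (limit_measure R \<alpha>) (\<lambda>x. ennreal (\<rho> x)))
          (space (density (limit_measure R \<alpha>) (\<lambda>x. ennreal (\<rho> x)))) = 1"
        by (simp add: emeasure_density cong: nn_integral_cong)
    qed
    fix c k
    define f where "f = (\<lambda>x. Re (c * circle_emb x ^ k))"
    have f: "continuous_on UNIV f"
      unfolding f_def by (intro continuous_intros continuous_circle_emb)
    have "avg (\<lambda>n. f (orbit S \<alpha> n)) \<longlonglongrightarrow> (1 / (1 / B)) *\<^sub>R ((\<integral>x. f x * \<rho> x \<partial>limit_measure R \<alpha>) / B)"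
      by (rule sub(3)[of "\<lambda>s. f (to_circle (real s * \<alpha>))"]) (simp add: in_S real_lim[OF f_def])
    then have "avg (\<lambda>n. f (orbit S \<alpha> n)) \<longlonglongrightarrow> (\<integral>x. f x * \<rho> x \<partial>limit_measure R \<alpha>)"
      using B by simp
    with limit_measure_tendsto[OF \<open>good S\<close> f]
    have "integral\<^sup>L (limit_measure S \<alpha>) f = (\<integral>x. f x * \<rho> x \<partial>limit_measure R \<alpha>)"
      by (rule LIMSEQ_unique)
    also have "\<dots> = integral\<^sup>L (density (limit_measure R \<alpha>) (\<lambda>x. ennreal (\<rho> x))) f"
      using measurable_continuous_circle[OF f sets_\<mu>] \<rho>(2)
      by (subst integral_density) (auto simp: mult.commute)
    finally show "(\<integral>x. Re (c * circle_emb x ^ k) \<partial>limit_measure S \<alpha>) =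
        (\<integral>x. Re (c * circle_emb x ^ k) \<partial>density (limit_measure R \<alpha>) (\<lambda>x. ennreal (\<rho> x)))"
      by (simp only: f_def)
  qed (use prob_space_limit_measure sets_limit_measure \<open>good S\<close> sets_\<mu> in auto)
  with \<open>S \<subseteq> R\<close> \<open>good S\<close> sub(2) show thesis
    by (intro that[of S]) auto
qed

text \<open>A function of integral 1 on a probability space has essential supremum at least 1, which keeps
  \<open>B\<close> away from zero.\<close>

lemma Linf_norm_density:
  fixes \<rho> :: "'a \<Rightarrow> real"
  assumes "prob_space M" and \<rho>: "integrable M \<rho>" "integral\<^sup>L M \<rho> = 1"
    and fin: "Linf_norm M (\<lambda>x. ereal (\<rho> x)) < \<infinity>"
  obtains B where "Linf_norm M (\<lambda>x. ereal (\<rho> x)) = ereal B" "1 \<le> B" "AE x in M. \<rho> x \<le> B"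
proof -
  interpret prob_space M by fact
  have ae: "AE x in M. \<bar>ereal (\<rho> x)\<bar> \<le> Linf_norm M (\<lambda>x. ereal (\<rho> x))"
    unfolding Linf_norm_def by (rule esssup_AE)
  have "Linf_norm M (\<lambda>x. ereal (\<rho> x)) \<noteq> -\<infinity>"
  proof
    assume "Linf_norm M (\<lambda>x. ereal (\<rho> x)) = -\<infinity>"
    with ae have "AE x in M. False" by simp
    then show False by simp
  qed
  with fin obtain B where B: "Linf_norm M (\<lambda>x. ereal (\<rho> x)) = ereal B"
    by (cases "Linf_norm M (\<lambda>x. ereal (\<rho> x))") auto
  have le: "AE x in M. \<rho> x \<le> B"
    using ae unfolding B by eventually_elim simp
  have "1 \<le> (\<integral>x. B \<partial>M)"
    unfolding \<rho>(2)[symmetric] using \<rho>(1) le by (intro integral_mono_AE) auto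
  then show thesis
    using that[OF B _ le] by (simp add: prob_space)
qed

theorem mainTheorem6:
  fixes R :: "nat set"
  assumes "good R" and "sublacunary R"
  shows
    "(\<forall>(\<alpha> :: real) (\<rho> :: circle \<Rightarrow> real).
        \<alpha> \<notin> \<rat> \<and>
        integrable (limit_measure R \<alpha>) \<rho> \<and>
        (AE x in limit_measure R \<alpha>. 0 \<le> \<rho> x) \<and>
        integral\<^sup>L (limit_measure R \<alpha>) \<rho> = 1 \<and>
        Linf_norm (limit_measure R \<alpha>) (\<lambda>x. ereal (\<rho> x)) < \<infinity>
        \<longrightarrow>
        (\<exists>S. S \<subseteq> R \<and> good S \<and>
             limit_measure S \<alpha> = density (limit_measure R \<alpha>) (\<lambda>x. ennreal (\<rho> x)) \<and>
             has_relative_mean R S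
               (1 / real_of_ereal (Linf_norm (limit_measure R \<alpha>) (\<lambda>x. ereal (\<rho> x))))))
     \<and>
     (\<forall>S. S \<subseteq> R \<and> good S \<and> 0 < upper_relative_mean R S
        \<longrightarrow>
        (\<forall>\<beta> :: real. \<beta> \<notin> \<rat> \<longrightarrow>
             absolutely_continuous (limit_measure R \<beta>) (limit_measure S \<beta>) \<and>
             Linf_norm (limit_measure R \<beta>)
               (\<lambda>x. enn2ereal (RN_deriv (limit_measure R \<beta>) (limit_measure S \<beta>) x)) < \<infinity> \<and>
             Linf_norm (limit_measure R \<beta>)
               (\<lambda>x. enn2ereal (RN_deriv (limit_measure R \<beta>) (limit_measure S \<beta>) x))
               \<le> 1 / upper_relative_mean R S))"
proof (intro conjI allI impI; elim conjE)
  fix \<alpha> :: real and \<rho> :: "circle \<Rightarrow> real"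
  assume \<rho>: "integrable (limit_measure R \<alpha>) \<rho>" "AE x in limit_measure R \<alpha>. 0 \<le> \<rho> x"
    "integral\<^sup>L (limit_measure R \<alpha>) \<rho> = 1"
    and fin: "Linf_norm (limit_measure R \<alpha>) (\<lambda>x. ereal (\<rho> x)) < \<infinity>"
  obtain B where B: "Linf_norm (limit_measure R \<alpha>) (\<lambda>x. ereal (\<rho> x)) = ereal B" "1 \<le> B"
    "AE x in limit_measure R \<alpha>. \<rho> x \<le> B"
    using Linf_norm_density[OF prob_space_limit_measure[OF assms(1)] \<rho>(1,3) fin] .
  show "\<exists>S. S \<subseteq> R \<and> good S \<and>
      limit_measure S \<alpha> = density (limit_measure R \<alpha>) (\<lambda>x. ennreal (\<rho> x)) \<and>
      has_relative_mean R S
        (1 / real_of_ereal (Linf_norm (limit_measure R \<alpha>) (\<lambda>x. ereal (\<rho> x))))"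
  proof -
    obtain S where "S \<subseteq> R" "good S"
      "limit_measure S \<alpha> = density (limit_measure R \<alpha>) (\<lambda>x. ennreal (\<rho> x))"
      "has_relative_mean R S (1 / B)"
      by (rule ex_good_subset_density[OF assms \<rho>(1,2) B(3) \<rho>(3) B(2)])
    then show ?thesis
      unfolding B(1) real_of_ereal.simps by (intro exI[of _ S] conjI)
  qed
next
  fix S and \<beta> :: real
  assume "S \<subseteq> R" "good S" "0 < upper_relative_mean R S"
  note * = good_subset_density[OF assms(1) \<open>good S\<close> \<open>S \<subseteq> R\<close> \<open>0 < upper_relative_mean R S\<close>]
  show "absolutely_continuous (limit_measure R \<beta>) (limit_measure S \<beta>)"
    by (rule *(1))
  show "Linf_norm (limit_measure R \<beta>)
      (\<lambda>x. enn2ereal (RN_deriv (limit_measure R \<beta>) (limit_measure S \<beta>) x)) < \<infinity>"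
    by (rule *(3))
  show "Linf_norm (limit_measure R \<beta>)
      (\<lambda>x. enn2ereal (RN_deriv (limit_measure R \<beta>) (limit_measure S \<beta>) x))
        \<le> 1 / upper_relative_mean R S"
    by (rule *(2))
qed

end
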